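(* Let $\alpha=(A,(A_i)_{i\in I_\alpha})$ and $\beta=(B,(B_i)_{i\in I_\beta})$ be coset incidence systems that are regular hypertopes, and let $\varphi: B\to\mathrm{Aut}(A)$ be a group homomorphism. If $\alpha$ is $(\beta,\varphi)$-admissible, then the twisting $\mathcal{T}(\alpha,\beta)$ (with respect to $\varphi$ and a choice of orbit representatives $(F_L)_{L\in K}$ as in the definition of admissibility) is a regular hypertope.
   Context: All type sets are finite. An incidence system over a type set $I$ consists of a set $X$ of elements, a type map $t:X\to I$, and a symmetric reflexive incidence relation $*$ on $X$ such that distinct incident elements have distinct types. A flag is a set of pairwise incident elements; its type is the set of types of its elements; a chamber is a flag of type $I$. The system is a geometry if all maximal flags are chambers. The residue of a flag $F$ is the incidence system formed by the elements incident to all elements of $F$ but not in $F$; for a geometry its rank is $|I|-|F|$. A geometry is residually connected if every residue (including that of the empty flag) of rank at least two has a connected incidence graph. It is thin if each residue of a flag of corank one contains exactly two elements. A coset incidence system $(G,(G_i)_{i\in I})$ consists of a group $G$ and subgroups $G_i\le G$; it is the incidence system over $I$ whose elements of type $i$ are the left cosets $gG_i$, with $gG_i$ incident to $kG_j$ iff $gG_i\cap kG_j\neq\emptyset$. For $J\subseteq I$ put $G_J=\bigcap_{j\in J}G_j$, with $G_\emptyset=G$; $G_I$ is the Borel subgroup. $G$ acts by left multiplication, and is flag-transitive if, for every $J\subseteq I$, it is transitive on the flags of type $J$. A regular hypertope is a thin, residually connected, flag-transitive incidence geometry. A coset incidence system $(G,(G_i)_{i\in I})$ is called a regular hypertope if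 it is a thin, residually connected geometry on which $G$ is flag-transitive. Convention: all thin coset geometries are taken with trivial Borel subgroup (one can always quotient by the Borel subgroup); in particular $A_{I_\alpha}$ and $B_{I_\beta}$ are trivial. Admissibility: $\alpha$ is $(\beta,\varphi)$-admissible if (1) the action $\varphi$ of $B$ on $A$ permutes the maximal parabolic subgroups $(A_i)_{i\in I_\alpha}$, so that $B$ acts on $I_\alpha$ with $\varphi(b)(A_i)=A_{b\cdot i}$; and (2) letting $K$ be the set of orbits of $B$ on $I_\alpha$, for each $L\in K$ there exists $F_L\in L$ such that for all $M,N\subseteq I_\beta$, ${}^LO_M\cap {}^LO_N={}^LO_{M\cap N}$, where ${}^LO_M$ is the orbit of $F_L$ under $B_{I_\beta\setminus M}$. Twisting: for $i\in I_\beta$ let ${}^LO^i$ be the orbit of $F_L$ under $B_i$. Fix representatives $(F_L)_{L\in K}$ satisfying (2). The twisting $\mathcal{T}(\alpha,\beta)$ is the coset incidence system $(G,(G_i)_{i\in I})$ over $I=I_\beta\sqcup K$ with $G=A\rtimes_\varphi B$, $G_i=A_{\bigcup_{L\in K}(L\setminus {}^LO^i)}\rtimes B_i$ if $i\in I_\beta$, and $G_i=A_i\rtimes B$ if $i\in K$ (here $i\subseteq I_\alpha$ is an orbit and $A_i=\bigcap_{l\in i}A_l$). *)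

theory Defs
  imports "HOL-Algebra.Left_Coset" "HOL-Algebra.Group_Action"
begin

section \<open>Incidence systems\<close>

record ('x, 'i) incidence =
  elements :: "'x set"
  types :: "'i set"
  type_of :: "'x \<Rightarrow> 'i"
  inc :: "'x \<Rightarrow> 'x \<Rightarrow> bool"

definition incidence_system :: "('x, 'i) incidence \<Rightarrow> bool" where
  "incidence_system \<Gamma> \<longleftrightarrow>
     finite (types \<Gamma>) \<and>
     type_of \<Gamma> \<in> elements \<Gamma> \<rightarrow> types \<Gamma> \<and>
     (\<forall>x\<in>elements \<Gamma>. inc \<Gamma> x x) \<and>
     (\<forall>x\<in>elements \<Gamma>. \<forall>y\<in>elements \<Gamma>. inc \<Gamma> x y \<longrightarrow> inc \<Gamma> y x) \<and>
     (\<forall>x\<in>elements \<Gamma>. \<forall>y\<in>elements \<Gamma>. inc \<Gamma> x y \<and> x \<noteq> y \<longrightarrow> type_of \<Gamma> x \<noteq> type_of \<Gamma> y)"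

definition flag :: "('x, 'i) incidence \<Rightarrow> 'x set \<Rightarrow> bool" where
  "flag \<Gamma> F \<longleftrightarrow> F \<subseteq> elements \<Gamma> \<and> (\<forall>x\<in>F. \<forall>y\<in>F. inc \<Gamma> x y)"

definition flag_type :: "('x, 'i) incidence \<Rightarrow> 'x set \<Rightarrow> 'i set" where
  "flag_type \<Gamma> F = type_of \<Gamma> ` F"

definition chamber :: "('x, 'i) incidence \<Rightarrow> 'x set \<Rightarrow> bool" where
  "chamber \<Gamma> F \<longleftrightarrow> flag \<Gamma> F \<and> flag_type \<Gamma> F = types \<Gamma>"

definition maximal_flag :: "('x, 'i) incidence \<Rightarrow> 'x set \<Rightarrow> bool" where
  "maximal_flag \<Gamma> F \<longleftrightarrow> flag \<Gamma> F \<and> (\<forall>F'. flag \<Gamma> F' \<and> F \<subseteq> F' \<longrightarrow> F' = F)"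

definition geometry :: "('x, 'i) incidence \<Rightarrow> bool" where
  "geometry \<Gamma> \<longleftrightarrow> incidence_system \<Gamma> \<and> (\<forall>F. maximal_flag \<Gamma> F \<longrightarrow> chamber \<Gamma> F)"

definition residue :: "('x, 'i) incidence \<Rightarrow> 'x set \<Rightarrow> ('x, 'i) incidence" where
  "residue \<Gamma> F =
     \<lparr>elements = {x \<in> elements \<Gamma> - F. \<forall>y\<in>F. inc \<Gamma> x y},
      types = types \<Gamma> - flag_type \<Gamma> F,
      type_of = type_of \<Gamma>,
      inc = inc \<Gamma>\<rparr>"

text \<open>For a flag of a geometry this is the rank of its residue. The subtraction does not truncate:
  elements of a flag have distinct types, so a flag has at most as many elements as there are types.\<close>

definition corank :: "('x, 'i) incidence \<Rightarrow> 'x set \<Rightarrow> nat" where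
  "corank \<Gamma> F = card (types \<Gamma>) - card F"

definition connected_incidence_graph :: "('x, 'i) incidence \<Rightarrow> bool" where
  "connected_incidence_graph \<Gamma> \<longleftrightarrow>
     (\<forall>x\<in>elements \<Gamma>. \<forall>y\<in>elements \<Gamma>.
        (x, y) \<in> {(u, v). u \<in> elements \<Gamma> \<and> v \<in> elements \<Gamma> \<and> inc \<Gamma> u v}\<^sup>*)"

definition residually_connected :: "('x, 'i) incidence \<Rightarrow> bool" where
  "residually_connected \<Gamma> \<longleftrightarrow>
     (\<forall>F. flag \<Gamma> F \<and> 2 \<le> corank \<Gamma> F \<longrightarrow> connected_incidence_graph (residue \<Gamma> F))"

definition thin :: "('x, 'i) incidence \<Rightarrow> bool" where
  "thin \<Gamma> \<longleftrightarrow> (\<forall>F. flag \<Gamma> F \<and> corank \<Gamma> F = 1 \<longrightarrow> card (elements (residue \<Gamma> F)) = 2)"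

section \<open>Coset incidence systems\<close>

record ('g, 'i) coset_system =
  grp :: "'g monoid"
  index :: "'i set"
  par :: "'i \<Rightarrow> 'g set"

definition coset_incidence_system :: "('g, 'i) coset_system \<Rightarrow> bool" where
  "coset_incidence_system \<alpha> \<longleftrightarrow>
     group (grp \<alpha>) \<and> finite (index \<alpha>) \<and> (\<forall>i\<in>index \<alpha>. subgroup (par \<alpha> i) (grp \<alpha>))"

text \<open>Elements carry their type, so that cosets of equal subgroups with different indices remain
  distinct elements.\<close>

definition coset_geometry :: "('g, 'i) coset_system \<Rightarrow> ('i \<times> 'g set, 'i) incidence" where
  "coset_geometry \<alpha> =
     \<lparr>elements = (SIGMA i:index \<alpha>. lcosets\<^bsub>grp \<alpha>\<^esub> par \<alpha> i),
      types = index \<alpha>,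
      type_of = fst,
      inc = (\<lambda>x y. snd x \<inter> snd y \<noteq> {})\<rparr>"

text \<open>The intersection with the carrier gives the convention that the empty set of indices yields
  the whole group.\<close>

definition parabolic :: "('g, 'i) coset_system \<Rightarrow> 'i set \<Rightarrow> 'g set" where
  "parabolic \<alpha> J = carrier (grp \<alpha>) \<inter> (\<Inter>j\<in>J. par \<alpha> j)"

definition borel :: "('g, 'i) coset_system \<Rightarrow> 'g set" where
  "borel \<alpha> = parabolic \<alpha> (index \<alpha>)"

definition left_mult :: "('g, 'i) coset_system \<Rightarrow> 'g \<Rightarrow> 'i \<times> 'g set \<Rightarrow> 'i \<times> 'g set" where
  "left_mult \<alpha> g x = (fst x, g <#\<^bsub>grp \<alpha>\<^esub> snd x)"

definition flag_transitive :: "('g, 'i) coset_system \<Rightarrow> bool" where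
  "flag_transitive \<alpha> \<longleftrightarrow>
     (\<forall>J\<subseteq>index \<alpha>. \<forall>F F'.
        flag (coset_geometry \<alpha>) F \<and> flag_type (coset_geometry \<alpha>) F = J \<and>
        flag (coset_geometry \<alpha>) F' \<and> flag_type (coset_geometry \<alpha>) F' = J \<longrightarrow>
        (\<exists>g\<in>carrier (grp \<alpha>). left_mult \<alpha> g ` F = F'))"

text \<open>The last conjunct is the convention that thin coset geometries are taken with trivial Borel
  subgroup.\<close>

definition regular_hypertope :: "('g, 'i) coset_system \<Rightarrow> bool" where
  "regular_hypertope \<alpha> \<longleftrightarrow>
     coset_incidence_system \<alpha> \<and>
     geometry (coset_geometry \<alpha>) \<and>
     thin (coset_geometry \<alpha>) \<and>
     residually_connected (coset_geometry \<alpha>) \<and>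
     flag_transitive \<alpha> \<and>
     borel \<alpha> = {\<one>\<^bsub>grp \<alpha>\<^esub>}"

section \<open>Admissibility and twisting\<close>

definition semidirect_product ::
    "('a, 'm) monoid_scheme \<Rightarrow> ('b, 'n) monoid_scheme \<Rightarrow> ('b \<Rightarrow> 'a \<Rightarrow> 'a) \<Rightarrow> ('a \<times> 'b) monoid" where
  "semidirect_product A B \<phi> =
     \<lparr>carrier = carrier A \<times> carrier B,
      mult = (\<lambda>(a, b) (a', b'). (a \<otimes>\<^bsub>A\<^esub> \<phi> b a', b \<otimes>\<^bsub>B\<^esub> b')),
      one = (\<one>\<^bsub>A\<^esub>, \<one>\<^bsub>B\<^esub>)\<rparr>"

text \<open>The index \<open>b \<cdot> i\<close> determined by \<open>\<phi>(b)(A_i) = A_(b \<cdot> i)\<close>. It is well defined as soon as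
  \<open>\<phi>(b)\<close> permutes the maximal parabolic subgroups and these are pairwise distinct; the latter holds
  in every regular hypertope with trivial Borel subgroup.\<close>

definition index_action :: "('a, 'i) coset_system \<Rightarrow> ('b \<Rightarrow> 'a \<Rightarrow> 'a) \<Rightarrow> 'b \<Rightarrow> 'i \<Rightarrow> 'i" where
  "index_action \<alpha> \<phi> b i = the_inv_into (index \<alpha>) (par \<alpha>) (\<phi> b ` par \<alpha> i)"

definition index_orbits ::
    "('a, 'i) coset_system \<Rightarrow> ('b, 'j) coset_system \<Rightarrow> ('b \<Rightarrow> 'a \<Rightarrow> 'a) \<Rightarrow> 'i set set" where
  "index_orbits \<alpha> \<beta> \<phi> = orbits (grp \<beta>) (index \<alpha>) (index_action \<alpha> \<phi>)"

definition sub_orbit ::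
    "('a, 'i) coset_system \<Rightarrow> ('b, 'j) coset_system \<Rightarrow> ('b \<Rightarrow> 'a \<Rightarrow> 'a) \<Rightarrow> 'b set \<Rightarrow> 'i \<Rightarrow> 'i set" where
  "sub_orbit \<alpha> \<beta> \<phi> H i = orbit ((grp \<beta>)\<lparr>carrier := H\<rparr>) (index_action \<alpha> \<phi>) i"

definition admissible_representative ::
    "('a, 'i) coset_system \<Rightarrow> ('b, 'j) coset_system \<Rightarrow> ('b \<Rightarrow> 'a \<Rightarrow> 'a) \<Rightarrow> 'i set \<Rightarrow> 'i \<Rightarrow> bool" where
  "admissible_representative \<alpha> \<beta> \<phi> L f \<longleftrightarrow>
     f \<in> L \<and>
     (\<forall>M\<subseteq>index \<beta>. \<forall>N\<subseteq>index \<beta>.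
        sub_orbit \<alpha> \<beta> \<phi> (parabolic \<beta> (index \<beta> - M)) f \<inter>
        sub_orbit \<alpha> \<beta> \<phi> (parabolic \<beta> (index \<beta> - N)) f =
        sub_orbit \<alpha> \<beta> \<phi> (parabolic \<beta> (index \<beta> - (M \<inter> N))) f)"

definition admissible ::
    "('a, 'i) coset_system \<Rightarrow> ('b, 'j) coset_system \<Rightarrow> ('b \<Rightarrow> 'a \<Rightarrow> 'a) \<Rightarrow> bool" where
  "admissible \<alpha> \<beta> \<phi> \<longleftrightarrow>
     (\<forall>b\<in>carrier (grp \<beta>). bij_betw ((`) (\<phi> b)) (par \<alpha> ` index \<alpha>) (par \<alpha> ` index \<alpha>)) \<and>
     (\<forall>L\<in>index_orbits \<alpha> \<beta> \<phi>. \<exists>f. admissible_representative \<alpha> \<beta> \<phi> L f)"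

text \<open>The representatives are given by a function \<open>F\<close> sending an orbit \<open>L\<close> to \<open>F_L\<close>. Since
  the carrier of the semidirect product is a set of pairs, its subset \<open>X \<rtimes> Y\<close> is \<open>X \<times> Y\<close>.\<close>

definition twisting ::
    "('a, 'i) coset_system \<Rightarrow> ('b, 'j) coset_system \<Rightarrow> ('b \<Rightarrow> 'a \<Rightarrow> 'a) \<Rightarrow> ('i set \<Rightarrow> 'i) \<Rightarrow>
     ('a \<times> 'b, 'j + 'i set) coset_system" where
  "twisting \<alpha> \<beta> \<phi> F =
     \<lparr>grp = semidirect_product (grp \<alpha>) (grp \<beta>) \<phi>,
      index = index \<beta> <+> index_orbits \<alpha> \<beta> \<phi>,
      par = case_sum
        (\<lambda>i. parabolic \<alpha> (\<Union>L\<in>index_orbits \<alpha> \<beta> \<phi>. L - sub_orbit \<alpha> \<beta> \<phi> (par \<beta> i) (F L)) \<times> par \<beta> i)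
        (\<lambda>L. parabolic \<alpha> L \<times> carrier (grp \<beta>))\<rparr>"

end

theory Submission
  imports Defs
begin

text \<open>
  For a coset incidence system with trivial Borel subgroup, being a regular hypertope amounts to three
  conditions on the parabolic subgroups: the elements of every flag share a group element (this is
  "geometry and flag-transitive"), the parabolics \<open>G_{I - {i}}\<close> have order two (thinness), and every
  \<open>G_J\<close> is generated by the \<open>G_{I - {i}}\<close> with \<open>i \<notin> J\<close> (residual connectedness).

  In the twisting, a left coset of a maximal parabolic is a product of a left coset of a parabolic of
  \<open>\<alpha>\<close> and a left coset of \<open>B_i\<close> or \<open>B\<close>. A flag therefore yields a flag of \<open>\<beta>\<close> and, since cosets
  of arbitrary parabolics of \<open>\<alpha>\<close> are themselves flags of \<open>\<alpha>\<close>, also a flag of \<open>\<alpha>\<close>; shared elements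
  of these two give a shared element of the flag. Admissibility turns the parabolic of type
  \<open>N \<squnion> M\<close> into \<open>A_{I_\<alpha> - U} \<rtimes> B_N\<close>, where \<open>U\<close> is the union of the orbits \<open>B_N F_L\<close> over \<open>L \<notin> M\<close>.
  This gives the orders at once, and generation follows because conjugation by \<open>B_N\<close> carries the
  involution of type \<open>F_L\<close> to all the involutions with type in \<open>B_N F_L\<close>.
\<close>

section \<open>Regular hypertopes in terms of parabolic subgroups\<close>

locale coset_incidence = group "grp \<alpha>" for \<alpha> :: "('g, 'i) coset_system" +
  assumes finite_index: "finite (index \<alpha>)"
    and par_subgroup: "i \<in> index \<alpha> \<Longrightarrow> subgroup (par \<alpha> i) (grp \<alpha>)"

lemma coset_incidence_system_iff: "coset_incidence_system \<alpha> \<longleftrightarrow> coset_incidence \<alpha>"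
  by (auto simp: coset_incidence_system_def coset_incidence_def coset_incidence_axioms_def)

text \<open>These are the translates by \<open>g\<close> of the flag of base cosets of type
  \<open>J\<close>. Flags with a common group element are exactly of this kind, so most arguments
  about flags reduce to them.\<close>

definition standard_flag :: "('g, 'i) coset_system \<Rightarrow> 'g \<Rightarrow> 'i set \<Rightarrow> ('i \<times> 'g set) set" where
  "standard_flag \<alpha> g J = (\<lambda>j. (j, g <#\<^bsub>grp \<alpha>\<^esub> par \<alpha> j)) ` J"

text \<open>Requiring \<open>g\<close> to lie in the carrier only adds something for the empty flag,
  since all cosets lie in the carrier.\<close>

definition flags_meet :: "('g, 'i) coset_system \<Rightarrow> bool" where
  "flags_meet \<alpha> \<longleftrightarrow> (\<forall>F. flag (coset_geometry \<alpha>) F \<longrightarrow> (\<exists>g\<in>carrier (grp \<alpha>). \<forall>x\<in>F. g \<in> snd x))"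

text \<open>Generation is expressed by a universal property: every subgroup containing the corank
  one parabolics contains \<open>G_J\<close>. For \<open>J = index \<alpha>\<close> the family of
  generators is empty, so this case forces the Borel subgroup to be trivial.\<close>

definition corank_one_generated :: "('g, 'i) coset_system \<Rightarrow> bool" where
  "corank_one_generated \<alpha> \<longleftrightarrow>
     (\<forall>J\<subseteq>index \<alpha>. \<forall>S. subgroup S (grp \<alpha>) \<and> (\<forall>i\<in>index \<alpha> - J. parabolic \<alpha> (index \<alpha> - {i}) \<subseteq> S)
        \<longrightarrow> parabolic \<alpha> J \<subseteq> S)"

section \<open>Cosets, parabolic subgroups and elements of the coset geometry\<close>

lemma (in group) mem_l_coset_iff:
  assumes "subgroup H G" "g \<in> carrier G"
  shows "x \<in> g <# H \<longleftrightarrow> x \<in> carrier G \<and> inv g \<otimes> x \<in> H"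
  using assms
  by (meson is_group subgroup.elemlcos_carrier subgroup.lcos_module_imp subgroup.lcos_module_rev)

lemma parabolic_subset: "parabolic \<alpha> J \<subseteq> carrier (grp \<alpha>)"
  by (auto simp: parabolic_def)

lemma parabolic_antimono: "J \<subseteq> K \<Longrightarrow> parabolic \<alpha> K \<subseteq> parabolic \<alpha> J"
  by (auto simp: parabolic_def)

context coset_incidence
begin

lemma parabolic_subgroup:
  assumes "J \<subseteq> index \<alpha>"
  shows "subgroup (parabolic \<alpha> J) (grp \<alpha>)"
proof -
  have "parabolic \<alpha> J = \<Inter> (insert (carrier (grp \<alpha>)) (par \<alpha> ` J))"
    by (auto simp: parabolic_def)
  moreover have "subgroup \<dots> (grp \<alpha>)"
    by (rule subgroups_Inter) (use assms par_subgroup subgroup_self in auto)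
  ultimately show ?thesis by simp
qed

lemma parabolic_singleton: "i \<in> index \<alpha> \<Longrightarrow> parabolic \<alpha> {i} = par \<alpha> i"
  using subgroup.subset[OF par_subgroup] by (auto simp: parabolic_def)

lemma parabolic_insert: "i \<in> index \<alpha> \<Longrightarrow> parabolic \<alpha> (insert i J) = par \<alpha> i \<inter> parabolic \<alpha> J"
  using subgroup.subset[OF par_subgroup] by (auto simp: parabolic_def)

lemma elements_iff:
  "x \<in> elements (coset_geometry \<alpha>) \<longleftrightarrow>
     (\<exists>i\<in>index \<alpha>. \<exists>g\<in>carrier (grp \<alpha>). x = (i, g <#\<^bsub>grp \<alpha>\<^esub> par \<alpha> i))"
  by (auto simp: coset_geometry_def LCOSETS_def)

lemma type_mem: "x \<in> elements (coset_geometry \<alpha>) \<Longrightarrow> fst x \<in> index \<alpha>"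
  by (auto simp: elements_iff)

lemma coset_repr:
  assumes "i \<in> index \<alpha>" "g \<in> carrier (grp \<alpha>)" "x \<in> g <#\<^bsub>grp \<alpha>\<^esub> par \<alpha> i"
  shows "x \<in> carrier (grp \<alpha>)" "g <#\<^bsub>grp \<alpha>\<^esub> par \<alpha> i = x <#\<^bsub>grp \<alpha>\<^esub> par \<alpha> i"
  using assms par_subgroup l_repr_independence mem_l_coset_iff by blast+

lemma element_repr:
  assumes "x \<in> elements (coset_geometry \<alpha>)" "g \<in> snd x"
  shows "g \<in> carrier (grp \<alpha>)" "snd x = g <#\<^bsub>grp \<alpha>\<^esub> par \<alpha> (fst x)"
proof -
  obtain i k where "i \<in> index \<alpha>" "k \<in> carrier (grp \<alpha>)" "x = (i, k <#\<^bsub>grp \<alpha>\<^esub> par \<alpha> i)"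
    using assms(1) unfolding elements_iff by blast
  then show "g \<in> carrier (grp \<alpha>)" "snd x = g <#\<^bsub>grp \<alpha>\<^esub> par \<alpha> (fst x)"
    using assms(2) coset_repr[of i k g] by simp_all
qed

lemma element_mem: "i \<in> index \<alpha> \<Longrightarrow> g \<in> carrier (grp \<alpha>) \<Longrightarrow> (i, g <#\<^bsub>grp \<alpha>\<^esub> par \<alpha> i) \<in> elements (coset_geometry \<alpha>)"
  by (auto simp: elements_iff)

lemma coset_self: "i \<in> index \<alpha> \<Longrightarrow> g \<in> carrier (grp \<alpha>) \<Longrightarrow> g \<in> g <#\<^bsub>grp \<alpha>\<^esub> par \<alpha> i"
  by (simp add: lcos_self par_subgroup)

lemma element_eqI:
  assumes "x \<in> elements (coset_geometry \<alpha>)" "y \<in> elements (coset_geometry \<alpha>)"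
    and "fst x = fst y" "snd x \<inter> snd y \<noteq> {}"
  shows "x = y"
proof -
  obtain g where "g \<in> snd x" "g \<in> snd y"
    using assms(4) by blast
  then show ?thesis
    using assms element_repr(2)[of x g] element_repr(2)[of y g] by (simp add: prod_eq_iff)
qed

lemma element_nonempty: "x \<in> elements (coset_geometry \<alpha>) \<Longrightarrow> snd x \<noteq> {}"
proof -
  assume "x \<in> elements (coset_geometry \<alpha>)"
  then obtain i k where "i \<in> index \<alpha>" "k \<in> carrier (grp \<alpha>)" "x = (i, k <#\<^bsub>grp \<alpha>\<^esub> par \<alpha> i)"
    unfolding elements_iff by blast
  then show ?thesis
    using coset_self[of i k] by auto
qed

section \<open>The incidence system, its flags, and common group elements of flags\<close>

lemma incidence_system: "incidence_system (coset_geometry \<alpha>)"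
  unfolding incidence_system_def
proof (intro conjI ballI impI)
  show "finite (types (coset_geometry \<alpha>))"
    by (simp add: coset_geometry_def finite_index)
  show "type_of (coset_geometry \<alpha>) \<in> elements (coset_geometry \<alpha>) \<rightarrow> types (coset_geometry \<alpha>)"
    by (auto simp: coset_geometry_def)
  fix x assume x: "x \<in> elements (coset_geometry \<alpha>)"
  show "inc (coset_geometry \<alpha>) x x"
    using element_nonempty[OF x] by (simp add: coset_geometry_def)
  fix y assume y: "y \<in> elements (coset_geometry \<alpha>)"
  show "inc (coset_geometry \<alpha>) x y \<Longrightarrow> inc (coset_geometry \<alpha>) y x"
    by (simp add: coset_geometry_def Int_commute)
  show "type_of (coset_geometry \<alpha>) x \<noteq> type_of (coset_geometry \<alpha>) y"
    if "inc (coset_geometry \<alpha>) x y \<and> x \<noteq> y"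
    using that element_eqI[OF x y] by (simp add: coset_geometry_def) blast
qed

lemma flag_iff:
  "flag (coset_geometry \<alpha>) F \<longleftrightarrow>
     F \<subseteq> elements (coset_geometry \<alpha>) \<and> (\<forall>x\<in>F. \<forall>y\<in>F. snd x \<inter> snd y \<noteq> {})"
  by (simp add: flag_def coset_geometry_def)

lemma flag_type_eq: "flag_type (coset_geometry \<alpha>) F = fst ` F"
  by (simp add: flag_type_def coset_geometry_def)

lemma types_eq: "types (coset_geometry \<alpha>) = index \<alpha>"
  by (simp add: coset_geometry_def)

text \<open>Incident elements of equal type are overlapping cosets of one subgroup, hence
  equal.\<close>

lemma flag_inj: "flag (coset_geometry \<alpha>) F \<Longrightarrow> inj_on fst F"
  unfolding flag_iff inj_on_def using element_eqI by blast

lemma flag_types_subset: "flag (coset_geometry \<alpha>) F \<Longrightarrow> fst ` F \<subseteq> index \<alpha>"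
  using type_mem by (auto simp: flag_iff)

lemma flag_standard_flag:
  "g \<in> carrier (grp \<alpha>) \<Longrightarrow> J \<subseteq> index \<alpha> \<Longrightarrow> flag (coset_geometry \<alpha>) (standard_flag \<alpha> g J)"
  unfolding flag_iff standard_flag_def using coset_self element_mem
  by (simp add: image_subset_iff disjoint_iff) blast

lemma fst_standard_flag: "fst ` standard_flag \<alpha> g J = J"
  by (force simp: standard_flag_def)

lemma flag_eq_standard_flag:
  assumes "flag (coset_geometry \<alpha>) F" "\<And>x. x \<in> F \<Longrightarrow> g \<in> snd x"
  shows "F = standard_flag \<alpha> g (fst ` F)"
proof -
  have "x = (fst x, g <#\<^bsub>grp \<alpha>\<^esub> par \<alpha> (fst x))" if "x \<in> F" for x
    using assms element_repr(2)[of x g] that unfolding flag_iff by (metis prod.collapse subsetD)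
  then show ?thesis
    unfolding standard_flag_def image_image by simp
qed

lemma left_mult_standard_flag:
  assumes "g \<in> carrier (grp \<alpha>)" "h \<in> carrier (grp \<alpha>)" "J \<subseteq> index \<alpha>"
  shows "left_mult \<alpha> g ` standard_flag \<alpha> h J = standard_flag \<alpha> (g \<otimes>\<^bsub>grp \<alpha>\<^esub> h) J"
  unfolding standard_flag_def left_mult_def image_image
proof (intro image_cong refl)
  fix j assume "j \<in> J"
  then have "par \<alpha> j \<subseteq> carrier (grp \<alpha>)"
    using assms par_subgroup subgroup.subset by blast
  then show "(fst (j, h <#\<^bsub>grp \<alpha>\<^esub> par \<alpha> j), g <#\<^bsub>grp \<alpha>\<^esub> snd (j, h <#\<^bsub>grp \<alpha>\<^esub> par \<alpha> j)) =
      (j, g \<otimes>\<^bsub>grp \<alpha>\<^esub> h <#\<^bsub>grp \<alpha>\<^esub> par \<alpha> j)"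
    using assms by (simp add: lcos_m_assoc)
qed

text \<open>Types are injective on a flag, so its size is at most the number of types; among the
  flags containing \<open>F\<close>, one of greatest size is maximal.\<close>

lemma flag_extends:
  assumes "flag (coset_geometry \<alpha>) F"
  shows "\<exists>C. maximal_flag (coset_geometry \<alpha>) C \<and> F \<subseteq> C"
proof -
  let ?P = "\<lambda>C. flag (coset_geometry \<alpha>) C \<and> F \<subseteq> C"
  have bound: "finite C \<and> card C \<le> card (index \<alpha>)" if "?P C" for C
    using that flag_inj[of C] flag_types_subset[of C] finite_index
    by (metis card_image card_mono finite_image_iff finite_subset)
  have "\<exists>C. ?P C \<and> (\<forall>D. ?P D \<longrightarrow> card D \<le> card C)"
    by (rule ex_has_greatest_nat[of ?P F card "Suc (card (index \<alpha>))"]) (use assms bound in \<open>auto simp: less_Suc_eq_le\<close>)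
  then obtain C where C: "?P C" and max: "\<And>D. ?P D \<Longrightarrow> card D \<le> card C"
    by blast
  have "D = C" if "flag (coset_geometry \<alpha>) D" "C \<subseteq> D" for D
    using that C max[of D] bound[of D] by (metis card_seteq order_trans)
  then show ?thesis
    using C unfolding maximal_flag_def by blast
qed

text \<open>A chamber is a translate of the chamber of base cosets, so its elements share a group element;
  conversely, a shared element makes a flag a translate of a base flag.\<close>

lemma flags_meet_iff: "geometry (coset_geometry \<alpha>) \<and> flag_transitive \<alpha> \<longleftrightarrow> flags_meet \<alpha>"
proof
  assume asm: "geometry (coset_geometry \<alpha>) \<and> flag_transitive \<alpha>"
  show "flags_meet \<alpha>"
    unfolding flags_meet_def
  proof (intro allI impI)
    fix F assume "flag (coset_geometry \<alpha>) F"
    then obtain C where C: "maximal_flag (coset_geometry \<alpha>) C" "F \<subseteq> C"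
      using flag_extends by blast
    then have "flag (coset_geometry \<alpha>) C" "fst ` C = index \<alpha>"
      using asm unfolding geometry_def chamber_def flag_type_eq types_eq by blast+
    moreover have "flag (coset_geometry \<alpha>) (standard_flag \<alpha> \<one>\<^bsub>grp \<alpha>\<^esub> (index \<alpha>))"
      by (simp add: flag_standard_flag)
    ultimately obtain g where g: "g \<in> carrier (grp \<alpha>)"
      "left_mult \<alpha> g ` standard_flag \<alpha> \<one>\<^bsub>grp \<alpha>\<^esub> (index \<alpha>) = C"
      using asm fst_standard_flag[of "\<one>\<^bsub>grp \<alpha>\<^esub>" "index \<alpha>"]
      unfolding flag_transitive_def flag_type_eq by (metis order_refl)
    then have "C = standard_flag \<alpha> g (index \<alpha>)"
      using left_mult_standard_flag[of g "\<one>\<^bsub>grp \<alpha>\<^esub>" "index \<alpha>"] by simp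
    then have "\<forall>x\<in>C. g \<in> snd x"
      using g(1) coset_self by (auto simp: standard_flag_def)
    then show "\<exists>g\<in>carrier (grp \<alpha>). \<forall>x\<in>F. g \<in> snd x"
      using g(1) C(2) by blast
  qed
next
  assume meet: "flags_meet \<alpha>"
  then have std: "\<exists>g\<in>carrier (grp \<alpha>). F = standard_flag \<alpha> g (fst ` F)"
    if "flag (coset_geometry \<alpha>) F" for F
    using that flag_eq_standard_flag unfolding flags_meet_def by metis
  have "chamber (coset_geometry \<alpha>) F" if F: "maximal_flag (coset_geometry \<alpha>) F" for F
  proof -
    have fl: "flag (coset_geometry \<alpha>) F"
      using F by (simp add: maximal_flag_def)
    then obtain g where g: "g \<in> carrier (grp \<alpha>)" "F = standard_flag \<alpha> g (fst ` F)"
      using std by blast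
    \<comment> \<open>All types can be filled in with cosets through the same \<open>g\<close>, so a
      maximal flag already has every type.\<close>
    have "F \<subseteq> standard_flag \<alpha> g (index \<alpha>)"
      by (subst g(2)) (use flag_types_subset[OF fl] in \<open>auto simp: standard_flag_def\<close>)
    then have "standard_flag \<alpha> g (index \<alpha>) = F"
      using F flag_standard_flag[OF g(1) order_refl] by (simp add: maximal_flag_def)
    then show ?thesis
      using fl fst_standard_flag[of g "index \<alpha>"] by (simp add: chamber_def flag_type_eq types_eq)
  qed
  then have "geometry (coset_geometry \<alpha>)"
    by (simp add: geometry_def incidence_system)
  moreover have "flag_transitive \<alpha>"
    unfolding flag_transitive_def flag_type_eq
  proof (intro allI impI)
    fix J F F'
    assume J: "J \<subseteq> index \<alpha>" and FF': "flag (coset_geometry \<alpha>) F \<and> fst ` F = J \<and>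
      flag (coset_geometry \<alpha>) F' \<and> fst ` F' = J"
    obtain g h where gh: "g \<in> carrier (grp \<alpha>)" "h \<in> carrier (grp \<alpha>)"
      "F = standard_flag \<alpha> g J" "F' = standard_flag \<alpha> h J"
      using std[of F] std[of F'] FF' by auto
    \<comment> \<open>The element \<open>h g^-1\<close> moves the cosets through \<open>g\<close> to
      the cosets through \<open>h\<close>.\<close>
    then have "left_mult \<alpha> (h \<otimes>\<^bsub>grp \<alpha>\<^esub> inv\<^bsub>grp \<alpha>\<^esub> g) ` F = F'"
      using J by (simp add: left_mult_standard_flag m_assoc)
    then show "\<exists>g\<in>carrier (grp \<alpha>). left_mult \<alpha> g ` F = F'"
      using gh by blast
  qed
  ultimately show "geometry (coset_geometry \<alpha>) \<and> flag_transitive \<alpha>" ..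
qed

section \<open>Residues of flags, and thinness as a condition on orders\<close>

lemma elements_residue_standard_flag:
  assumes meet: "flags_meet \<alpha>" and g: "g \<in> carrier (grp \<alpha>)" and J: "J \<subseteq> index \<alpha>"
  shows "elements (residue (coset_geometry \<alpha>) (standard_flag \<alpha> g J)) =
    {(i, (g \<otimes>\<^bsub>grp \<alpha>\<^esub> h) <#\<^bsub>grp \<alpha>\<^esub> par \<alpha> i) |i h. i \<in> index \<alpha> - J \<and> h \<in> parabolic \<alpha> J}"
    (is "?L = ?R")
proof
  have inL: "x \<in> ?L \<longleftrightarrow> x \<in> elements (coset_geometry \<alpha>) \<and> x \<notin> standard_flag \<alpha> g J \<and>
      (\<forall>y\<in>standard_flag \<alpha> g J. snd x \<inter> snd y \<noteq> {})" for x
    by (auto simp: residue_def coset_geometry_def)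
  show "?L \<subseteq> ?R"
  proof
    fix x assume "x \<in> ?L"
    then have x: "x \<in> elements (coset_geometry \<alpha>)" "x \<notin> standard_flag \<alpha> g J"
      "\<forall>y\<in>standard_flag \<alpha> g J. snd x \<inter> snd y \<noteq> {}"
      using inL by auto
    \<comment> \<open>An element of the residue extends the flag, so it shares some \<open>k\<close>
      with all its members. Then \<open>k\<close> represents \<open>x\<close> and lies in
      \<open>g G_J\<close>, which makes \<open>g^-1 k\<close> the required \<open>h\<close>.\<close>
    have "flag (coset_geometry \<alpha>) (insert x (standard_flag \<alpha> g J))"
      using x flag_standard_flag[OF g J] element_nonempty[OF x(1)] unfolding flag_iff
      by (simp add: Int_commute)
    then obtain k where k: "k \<in> carrier (grp \<alpha>)" "k \<in> snd x" "\<forall>y\<in>standard_flag \<alpha> g J. k \<in> snd y"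
      using meet unfolding flags_meet_def by blast
    have kj: "k \<in> g <#\<^bsub>grp \<alpha>\<^esub> par \<alpha> j" if "j \<in> J" for j
      using k(3) that by (auto simp: standard_flag_def)
    have x_eq: "x = (fst x, k <#\<^bsub>grp \<alpha>\<^esub> par \<alpha> (fst x))"
      using element_repr(2)[OF x(1) k(2)] by (metis prod.collapse)
    \<comment> \<open>Otherwise \<open>x\<close> and the flag member of the same type are both the
      coset through \<open>k\<close>, so \<open>x\<close> would belong to the flag.\<close>
    have "fst x \<notin> J"
    proof
      assume "fst x \<in> J"
      then have "x = (fst x, g <#\<^bsub>grp \<alpha>\<^esub> par \<alpha> (fst x))"
        using x_eq coset_repr(2) g J kj by (metis subsetD)
      then show False
        using x(2) \<open>fst x \<in> J\<close> unfolding standard_flag_def by blast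
    qed
    moreover have "inv\<^bsub>grp \<alpha>\<^esub> g \<otimes>\<^bsub>grp \<alpha>\<^esub> k \<in> parabolic \<alpha> J"
      using kj g J k(1) mem_l_coset_iff[OF par_subgroup g] by (auto simp: parabolic_def)
    moreover have "g \<otimes>\<^bsub>grp \<alpha>\<^esub> (inv\<^bsub>grp \<alpha>\<^esub> g \<otimes>\<^bsub>grp \<alpha>\<^esub> k) = k"
      using g k(1) by (simp add: m_assoc[symmetric])
    ultimately show "x \<in> ?R"
      using type_mem[OF x(1)] x_eq
      by (intro CollectI exI[of _ "fst x"] exI[of _ "inv\<^bsub>grp \<alpha>\<^esub> g \<otimes>\<^bsub>grp \<alpha>\<^esub> k"]) simp
  qed
  show "?R \<subseteq> ?L"
  proof
    fix x assume "x \<in> ?R"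
    then obtain i h where ih: "i \<in> index \<alpha>" "i \<notin> J" "h \<in> parabolic \<alpha> J"
      "x = (i, (g \<otimes>\<^bsub>grp \<alpha>\<^esub> h) <#\<^bsub>grp \<alpha>\<^esub> par \<alpha> i)"
      by blast
    have h: "h \<in> carrier (grp \<alpha>)"
      using ih(3) parabolic_subset[of \<alpha> J] by blast
    have "g \<otimes>\<^bsub>grp \<alpha>\<^esub> h \<in> g <#\<^bsub>grp \<alpha>\<^esub> par \<alpha> j" if "j \<in> J" for j
      using that ih(3) by (auto simp: l_coset_def parabolic_def)
    moreover have "g \<otimes>\<^bsub>grp \<alpha>\<^esub> h \<in> snd x"
      using ih g h coset_self by simp
    ultimately have "\<forall>y\<in>standard_flag \<alpha> g J. snd x \<inter> snd y \<noteq> {}"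
      by (auto simp: standard_flag_def)
    moreover have "x \<notin> standard_flag \<alpha> g J"
      using ih by (auto simp: standard_flag_def)
    ultimately show "x \<in> ?L"
      using inL ih g h element_mem by auto
  qed
qed


text \<open>Sending \<open>h\<close> to the coset \<open>g h G_i\<close> maps
  \<open>G_{I - {i}}\<close> onto the residue. If \<open>h\<close> and \<open>k\<close> give the
  same coset, then \<open>h^-1 k\<close> lies in \<open>G_i\<close> and in
  \<open>G_{I - {i}}\<close>, thus in the trivial Borel subgroup, so the map is injective.\<close>

lemma card_residue_standard_flag:
  assumes meet: "flags_meet \<alpha>" and borel: "borel \<alpha> = {\<one>\<^bsub>grp \<alpha>\<^esub>}"
    and g: "g \<in> carrier (grp \<alpha>)" and i: "i \<in> index \<alpha>"
  shows "card (elements (residue (coset_geometry \<alpha>) (standard_flag \<alpha> g (index \<alpha> - {i})))) =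
    card (parabolic \<alpha> (index \<alpha> - {i}))"
proof -
  let ?H = "parabolic \<alpha> (index \<alpha> - {i})"
  let ?f = "\<lambda>h. (i, g \<otimes>\<^bsub>grp \<alpha>\<^esub> h <#\<^bsub>grp \<alpha>\<^esub> par \<alpha> i)"
  interpret H: subgroup ?H "grp \<alpha>"
    by (rule parabolic_subgroup) simp
  have "inj_on ?f ?H"
  proof (rule inj_onI)
    fix h k assume hk: "h \<in> ?H" "k \<in> ?H" "?f h = ?f k"
    have carr: "h \<in> carrier (grp \<alpha>)" "k \<in> carrier (grp \<alpha>)"
      using hk H.mem_carrier by simp_all
    have "g \<otimes>\<^bsub>grp \<alpha>\<^esub> k \<in> g \<otimes>\<^bsub>grp \<alpha>\<^esub> h <#\<^bsub>grp \<alpha>\<^esub> par \<alpha> i"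
      using coset_self[of i "g \<otimes>\<^bsub>grp \<alpha>\<^esub> k"] hk(3) g i carr by simp
    then have "inv\<^bsub>grp \<alpha>\<^esub> (g \<otimes>\<^bsub>grp \<alpha>\<^esub> h) \<otimes>\<^bsub>grp \<alpha>\<^esub> (g \<otimes>\<^bsub>grp \<alpha>\<^esub> k) \<in> par \<alpha> i"
      using mem_l_coset_iff[OF par_subgroup[OF i]] g carr by simp
    moreover have "inv\<^bsub>grp \<alpha>\<^esub> (g \<otimes>\<^bsub>grp \<alpha>\<^esub> h) \<otimes>\<^bsub>grp \<alpha>\<^esub> (g \<otimes>\<^bsub>grp \<alpha>\<^esub> k) = inv\<^bsub>grp \<alpha>\<^esub> h \<otimes>\<^bsub>grp \<alpha>\<^esub> k"
      using g carr by (simp add: inv_mult_group m_assoc[symmetric]) (simp add: m_assoc)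
    ultimately have "inv\<^bsub>grp \<alpha>\<^esub> h \<otimes>\<^bsub>grp \<alpha>\<^esub> k \<in> ?H \<inter> par \<alpha> i"
      using hk by simp
    then have "inv\<^bsub>grp \<alpha>\<^esub> h \<otimes>\<^bsub>grp \<alpha>\<^esub> k \<in> borel \<alpha>"
      unfolding borel_def parabolic_def by blast
    then have "inv\<^bsub>grp \<alpha>\<^esub> h \<otimes>\<^bsub>grp \<alpha>\<^esub> k = \<one>\<^bsub>grp \<alpha>\<^esub>"
      by (simp add: borel)
    then show "h = k"
      using carr by (metis inv_equality inv_inv inv_closed)
  qed
  moreover have "elements (residue (coset_geometry \<alpha>) (standard_flag \<alpha> g (index \<alpha> - {i}))) = ?f ` ?H"
    using elements_residue_standard_flag[OF meet g, of "index \<alpha> - {i}"] i by auto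
  ultimately show ?thesis
    by (simp add: card_image)
qed

lemma corank_flag:
  assumes "flag (coset_geometry \<alpha>) F"
  shows "corank (coset_geometry \<alpha>) F = card (index \<alpha> - fst ` F)"
proof -
  have "fst ` F \<subseteq> index \<alpha>" "card (fst ` F) = card F"
    using assms flag_inj flag_types_subset by (simp_all add: card_image)
  then show ?thesis
    using finite_index by (simp add: corank_def types_eq card_Diff_subset finite_subset)
qed

lemma flags_meet_standard_flag:
  assumes "flags_meet \<alpha>" "flag (coset_geometry \<alpha>) F"
  obtains g where "g \<in> carrier (grp \<alpha>)" "F = standard_flag \<alpha> g (fst ` F)"
  using assms flag_eq_standard_flag unfolding flags_meet_def by metis

text \<open>A flag of corank one misses exactly one type \<open>i\<close>; since its elements share
  some \<open>g\<close>, it is a standard flag and its residue is counted by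
  \<open>G_{I - {i}}\<close>.\<close>

lemma thin_iff:
  assumes meet: "flags_meet \<alpha>" and borel: "borel \<alpha> = {\<one>\<^bsub>grp \<alpha>\<^esub>}"
  shows "thin (coset_geometry \<alpha>) \<longleftrightarrow> (\<forall>i\<in>index \<alpha>. card (parabolic \<alpha> (index \<alpha> - {i})) = 2)"
proof
  assume thin: "thin (coset_geometry \<alpha>)"
  show "\<forall>i\<in>index \<alpha>. card (parabolic \<alpha> (index \<alpha> - {i})) = 2"
  proof
    fix i assume i: "i \<in> index \<alpha>"
    let ?F = "standard_flag \<alpha> \<one>\<^bsub>grp \<alpha>\<^esub> (index \<alpha> - {i})"
    have flag: "flag (coset_geometry \<alpha>) ?F"
      by (simp add: flag_standard_flag)
    moreover have "index \<alpha> - (index \<alpha> - {i}) = {i}"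
      using i by blast
    ultimately have "corank (coset_geometry \<alpha>) ?F = 1"
      by (simp add: corank_flag fst_standard_flag)
    then have "card (elements (residue (coset_geometry \<alpha>) ?F)) = 2"
      using thin flag by (simp add: thin_def)
    then show "card (parabolic \<alpha> (index \<alpha> - {i})) = 2"
      by (simp add: card_residue_standard_flag[OF meet borel _ i])
  qed
next
  assume card: "\<forall>i\<in>index \<alpha>. card (parabolic \<alpha> (index \<alpha> - {i})) = 2"
  show "thin (coset_geometry \<alpha>)"
    unfolding thin_def
  proof (intro allI impI, elim conjE)
    fix F assume F: "flag (coset_geometry \<alpha>) F" "corank (coset_geometry \<alpha>) F = 1"
    obtain g where g: "g \<in> carrier (grp \<alpha>)" "F = standard_flag \<alpha> g (fst ` F)"
      using flags_meet_standard_flag[OF meet F(1)] .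
    obtain i where "index \<alpha> - fst ` F = {i}"
      using F(2) by (auto simp: corank_flag[OF F(1)] card_1_singleton_iff)
    then have i: "i \<in> index \<alpha>" "fst ` F = index \<alpha> - {i}"
      using flag_types_subset[OF F(1)] by blast+
    show "card (elements (residue (coset_geometry \<alpha>) F)) = 2"
      using card_residue_standard_flag[OF meet borel g(1) i(1)] card i g(2) by simp
  qed
qed

section \<open>Residual connectedness as generation of parabolic subgroups\<close>

lemma parabolic_generated:
  assumes meet: "flags_meet \<alpha>" and conn: "residually_connected (coset_geometry \<alpha>)"
    and J: "J \<subseteq> index \<alpha>" "2 \<le> card (index \<alpha> - J)"
    and S: "subgroup S (grp \<alpha>)" "\<And>i. i \<in> index \<alpha> - J \<Longrightarrow> parabolic \<alpha> (insert i J) \<subseteq> S"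
  shows "parabolic \<alpha> J \<subseteq> S"
proof
  interpret S: subgroup S "grp \<alpha>" by (rule S(1))
  interpret P: subgroup "parabolic \<alpha> J" "grp \<alpha>" by (rule parabolic_subgroup[OF J(1)])
  let ?F = "standard_flag \<alpha> \<one>\<^bsub>grp \<alpha>\<^esub> J"
  let ?R = "residue (coset_geometry \<alpha>) ?F"
  \<comment> \<open>The residue elements that have a representative in \<open>S\<close>. This set is
    closed under incidence within the residue, so by connectedness it contains \<open>h G_i\<close>
    for every \<open>h\<close> in \<open>G_J\<close>.\<close>
  let ?T = "{(i, s <#\<^bsub>grp \<alpha>\<^esub> par \<alpha> i) |i s. i \<in> index \<alpha> - J \<and> s \<in> parabolic \<alpha> J \<inter> S}"
  have elts: "elements ?R = {(i, h <#\<^bsub>grp \<alpha>\<^esub> par \<alpha> i) |i h. i \<in> index \<alpha> - J \<and> h \<in> parabolic \<alpha> J}"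
    by (simp add: elements_residue_standard_flag[OF meet one_closed J(1)] cong: rev_conj_cong)
  have closed: "y \<in> ?T" if x: "x \<in> ?T" and y: "y \<in> elements ?R" and xy: "snd x \<inter> snd y \<noteq> {}" for x y
  proof -
    obtain i s where i: "i \<in> index \<alpha> - J" and s: "s \<in> parabolic \<alpha> J" "s \<in> S"
      and x_eq: "x = (i, s <#\<^bsub>grp \<alpha>\<^esub> par \<alpha> i)"
      using x by blast
    have s_carr: "s \<in> carrier (grp \<alpha>)" using s S.mem_carrier by blast
    have y': "y \<in> elements (coset_geometry \<alpha>)" "\<forall>z\<in>?F. snd y \<inter> snd z \<noteq> {}" "fst y \<in> index \<alpha> - J"
      using y by (simp_all add: residue_def coset_geometry_def) (use y elts in auto)
    have x': "x \<in> elements (coset_geometry \<alpha>)"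
      using i s_carr x_eq element_mem by simp
    have "s \<in> \<one>\<^bsub>grp \<alpha>\<^esub> <#\<^bsub>grp \<alpha>\<^esub> par \<alpha> j" if "j \<in> J" for j
      using that s J(1) s_carr mem_l_coset_iff[OF par_subgroup one_closed] by (auto simp: parabolic_def)
    moreover have "s \<in> snd x"
      using coset_self i s_carr x_eq by simp
    ultimately have "\<forall>z\<in>?F. snd x \<inter> snd z \<noteq> {}"
      by (auto simp: standard_flag_def)
    \<comment> \<open>A common element \<open>k\<close> of this larger flag represents
      \<open>y\<close> and lies in \<open>G_J\<close>. As it also lies in \<open>s G_i\<close>, the
      quotient \<open>s^-1 k\<close> is in \<open>G_{J \<union> {i}}\<close>, which \<open>S\<close>
      contains; so \<open>k\<close> is in \<open>S\<close>.\<close>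
    then have "flag (coset_geometry \<alpha>) (insert x (insert y ?F))"
      using x' y' xy flag_standard_flag[OF one_closed J(1)] element_nonempty[OF x'] element_nonempty[OF y'(1)]
      unfolding flag_iff by (simp add: Int_commute)
    then obtain k where k: "k \<in> carrier (grp \<alpha>)" "k \<in> snd x" "k \<in> snd y" "\<forall>z\<in>?F. k \<in> snd z"
      using meet unfolding flags_meet_def by blast
    have "k \<in> par \<alpha> j" if j: "j \<in> J" for j
    proof -
      have "k \<in> \<one>\<^bsub>grp \<alpha>\<^esub> <#\<^bsub>grp \<alpha>\<^esub> par \<alpha> j"
        using k(4) j by (auto simp: standard_flag_def)
      then show ?thesis
        using j J(1) k(1) mem_l_coset_iff[OF par_subgroup one_closed, of j k] by auto
    qed
    then have kJ: "k \<in> parabolic \<alpha> J"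
      using k(1) by (simp add: parabolic_def)
    have "inv\<^bsub>grp \<alpha>\<^esub> s \<otimes>\<^bsub>grp \<alpha>\<^esub> k \<in> par \<alpha> i"
      using k(2) x_eq mem_l_coset_iff[OF par_subgroup s_carr] i by simp
    moreover have "inv\<^bsub>grp \<alpha>\<^esub> s \<otimes>\<^bsub>grp \<alpha>\<^esub> k \<in> parabolic \<alpha> J"
      using s kJ by simp
    ultimately have "inv\<^bsub>grp \<alpha>\<^esub> s \<otimes>\<^bsub>grp \<alpha>\<^esub> k \<in> parabolic \<alpha> (insert i J)"
      using i parabolic_insert by blast
    then have "s \<otimes>\<^bsub>grp \<alpha>\<^esub> (inv\<^bsub>grp \<alpha>\<^esub> s \<otimes>\<^bsub>grp \<alpha>\<^esub> k) \<in> S"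
      using S(2)[OF i] s(2) by blast
    then have "k \<in> S"
      using s_carr k(1) by (simp add: m_assoc[symmetric])
    then show ?thesis
      using kJ y'(3) element_repr(2)[OF y'(1) k(3)]
      by (intro CollectI exI[of _ "fst y"] exI[of _ k]) (simp add: prod_eq_iff)
  qed
  fix h assume h: "h \<in> parabolic \<alpha> J"
  have "index \<alpha> - J \<noteq> {}"
    using J(2) by (metis card.empty not_numeral_le_zero)
  then obtain i where i: "i \<in> index \<alpha> - J" by blast
  let ?x = "(i, \<one>\<^bsub>grp \<alpha>\<^esub> <#\<^bsub>grp \<alpha>\<^esub> par \<alpha> i)" and ?y = "(i, h <#\<^bsub>grp \<alpha>\<^esub> par \<alpha> i)"
  have "flag (coset_geometry \<alpha>) ?F" "corank (coset_geometry \<alpha>) ?F \<ge> 2"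
    using J flag_standard_flag corank_flag by (simp_all add: fst_standard_flag)
  then have "connected_incidence_graph ?R"
    using conn by (simp add: residually_connected_def)
  moreover have "?x \<in> elements ?R" "?y \<in> elements ?R"
    unfolding elts using i h P.one_closed by auto
  ultimately have "(?x, ?y) \<in> {(u, v). u \<in> elements ?R \<and> v \<in> elements ?R \<and> inc ?R u v}\<^sup>*"
    by (simp add: connected_incidence_graph_def)
  \<comment> \<open>Induction along a path from the base coset \<open>G_i\<close> to
    \<open>h G_i\<close>.\<close>
  then have "?y \<in> ?T"
  proof (induction rule: rtrancl_induct)
    case base
    show ?case using i by auto
  next
    case (step y z)
    then show ?case
      using closed[of y z]
      by (simp add: residue_def coset_geometry_def)
  qed
  then obtain s where s: "s \<in> parabolic \<alpha> J" "s \<in> S" "h <#\<^bsub>grp \<alpha>\<^esub> par \<alpha> i = s <#\<^bsub>grp \<alpha>\<^esub> par \<alpha> i"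
    by blast
  \<comment> \<open>The coset \<open>h G_i\<close> has a representative \<open>s\<close> in
    \<open>S\<close>; the difference \<open>s^-1 h\<close> again falls into
    \<open>G_{J \<union> {i}}\<close>.\<close>
  then have "inv\<^bsub>grp \<alpha>\<^esub> s \<otimes>\<^bsub>grp \<alpha>\<^esub> h \<in> par \<alpha> i"
    using coset_self[of i h] i h mem_l_coset_iff[OF par_subgroup S.mem_carrier[OF s(2)]] by auto
  moreover have "inv\<^bsub>grp \<alpha>\<^esub> s \<otimes>\<^bsub>grp \<alpha>\<^esub> h \<in> parabolic \<alpha> J"
    using s h by simp
  ultimately have "inv\<^bsub>grp \<alpha>\<^esub> s \<otimes>\<^bsub>grp \<alpha>\<^esub> h \<in> parabolic \<alpha> (insert i J)"
    using i parabolic_insert by blast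
  then have "s \<otimes>\<^bsub>grp \<alpha>\<^esub> (inv\<^bsub>grp \<alpha>\<^esub> s \<otimes>\<^bsub>grp \<alpha>\<^esub> h) \<in> S"
    using S(2)[OF i] s(2) by blast
  then show "h \<in> S"
    using s(1) h by (simp add: m_assoc[symmetric])
qed

text \<open>Induction on the number of types outside \<open>J\<close>. Connectedness is available
  only from rank two on, so ranks zero (trivial Borel subgroup) and one (a generator itself) are the
  base cases.\<close>

lemma corank_one_generatedI:
  assumes meet: "flags_meet \<alpha>" and conn: "residually_connected (coset_geometry \<alpha>)"
    and borel: "borel \<alpha> = {\<one>\<^bsub>grp \<alpha>\<^esub>}"
  shows "corank_one_generated \<alpha>"
  unfolding corank_one_generated_def
proof (intro allI impI, elim conjE)
  fix J S
  assume J: "J \<subseteq> index \<alpha>" and S: "subgroup S (grp \<alpha>)"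
    and "\<forall>i\<in>index \<alpha> - J. parabolic \<alpha> (index \<alpha> - {i}) \<subseteq> S"
  then show "parabolic \<alpha> J \<subseteq> S"
  proof (induction "card (index \<alpha> - J)" arbitrary: J rule: less_induct)
    case less
    consider "index \<alpha> - J = {}" | i where "index \<alpha> - J = {i}" | "2 \<le> card (index \<alpha> - J)"
      using finite_index
      by (metis One_nat_def card_1_singletonE card_eq_0_iff finite_Diff less_2_cases not_le)
    then show ?case
    proof cases
      case 1
      then have "J = index \<alpha>" using less.prems(1) by blast
      then show ?thesis
        using borel S subgroup.one_closed by (auto simp: borel_def)
    next
      case (2 i)
      then have "J = index \<alpha> - {i}" "i \<in> index \<alpha> - J" using less.prems(1) by blast+
      then show ?thesis using less.prems(3) by auto
    next
      case 3
      have "parabolic \<alpha> (insert i J) \<subseteq> S" if i: "i \<in> index \<alpha> - J" for i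
      proof (rule less.hyps)
        show "card (index \<alpha> - insert i J) < card (index \<alpha> - J)"
          by (rule psubset_card_mono) (use i finite_index in auto)
      qed (use i less.prems in auto)
      then show ?thesis
        using parabolic_generated[OF meet conn less.prems(1) 3 S] by blast
    qed
  qed
qed

text \<open>The right multipliers that never leave a connected component of the residue form a
  subgroup. It contains the generators of \<open>G_J\<close>, hence all of \<open>G_J\<close>, and
  so any two elements of the residue are joined.\<close>

lemma residually_connectedI:
  assumes meet: "flags_meet \<alpha>" and gen: "corank_one_generated \<alpha>"
  shows "residually_connected (coset_geometry \<alpha>)"
  unfolding residually_connected_def
proof (intro allI impI, elim conjE)
  fix F assume F: "flag (coset_geometry \<alpha>) F" "2 \<le> corank (coset_geometry \<alpha>) F"
  define J where "J = fst ` F"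
  have J: "J \<subseteq> index \<alpha>" "2 \<le> card (index \<alpha> - J)"
    using F flag_types_subset corank_flag by (auto simp: J_def)
  interpret P: subgroup "parabolic \<alpha> J" "grp \<alpha>" by (rule parabolic_subgroup[OF J(1)])
  obtain g where g: "g \<in> carrier (grp \<alpha>)" "F = standard_flag \<alpha> g J"
    using flags_meet_standard_flag[OF meet F(1)] unfolding J_def .
  let ?R = "residue (coset_geometry \<alpha>) F"
  define E where "E = {(u, v). u \<in> elements ?R \<and> v \<in> elements ?R \<and> inc ?R u v}"
  define el where "el = (\<lambda>i h. (i, (g \<otimes>\<^bsub>grp \<alpha>\<^esub> h) <#\<^bsub>grp \<alpha>\<^esub> par \<alpha> i))"
  have elts: "elements ?R = {el i h |i h. i \<in> index \<alpha> - J \<and> h \<in> parabolic \<alpha> J}"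
    unfolding el_def g(2) by (rule elements_residue_standard_flag[OF meet g(1) J(1)])
  have inc: "(el i h, el k h) \<in> E" if "i \<in> index \<alpha> - J" "k \<in> index \<alpha> - J" "h \<in> parabolic \<alpha> J" for i k h
  proof -
    have "g \<otimes>\<^bsub>grp \<alpha>\<^esub> h \<in> snd (el i h) \<inter> snd (el k h)"
      using that g(1) coset_self by (simp add: el_def)
    then show ?thesis
      using that elts by (auto simp: E_def residue_def coset_geometry_def)
  qed
  \<comment> \<open>Quantifying over every \<open>h\<close> lets paths be concatenated for products,
    and started at \<open>h s^-1\<close> and reversed for inverses.\<close>
  define S where "S = {s \<in> parabolic \<alpha> J. \<forall>i\<in>index \<alpha> - J. \<forall>h\<in>parabolic \<alpha> J. (el i h, el i (h \<otimes>\<^bsub>grp \<alpha>\<^esub> s)) \<in> E\<^sup>*}"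
  have "sym E"
    by (auto simp: E_def sym_def residue_def coset_geometry_def Int_commute)
  then have sym: "(v, u) \<in> E\<^sup>*" if "(u, v) \<in> E\<^sup>*" for u v
    using that by (metis sym_rtrancl symD)
  have "subgroup S (grp \<alpha>)"
  proof (rule subgroupI)
    show "S \<subseteq> carrier (grp \<alpha>)"
      by (auto simp: S_def)
    have "\<one>\<^bsub>grp \<alpha>\<^esub> \<in> S"
      by (simp add: S_def)
    then show "S \<noteq> {}" by blast
  next
    fix s assume s: "s \<in> S"
    have "(el i h, el i (h \<otimes>\<^bsub>grp \<alpha>\<^esub> inv\<^bsub>grp \<alpha>\<^esub> s)) \<in> E\<^sup>*"
      if ih: "i \<in> index \<alpha> - J" "h \<in> parabolic \<alpha> J" for i h
    proof -
      have "(el i (h \<otimes>\<^bsub>grp \<alpha>\<^esub> inv\<^bsub>grp \<alpha>\<^esub> s), el i (h \<otimes>\<^bsub>grp \<alpha>\<^esub> inv\<^bsub>grp \<alpha>\<^esub> s \<otimes>\<^bsub>grp \<alpha>\<^esub> s)) \<in> E\<^sup>*"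
        using s ih by (simp add: S_def)
      moreover have "h \<otimes>\<^bsub>grp \<alpha>\<^esub> inv\<^bsub>grp \<alpha>\<^esub> s \<otimes>\<^bsub>grp \<alpha>\<^esub> s = h"
        using s ih by (simp add: S_def m_assoc)
      ultimately show ?thesis using sym by simp
    qed
    then show "inv\<^bsub>grp \<alpha>\<^esub> s \<in> S"
      using s by (simp add: S_def)
  next
    fix s t assume st: "s \<in> S" "t \<in> S"
    have "(el i h, el i (h \<otimes>\<^bsub>grp \<alpha>\<^esub> (s \<otimes>\<^bsub>grp \<alpha>\<^esub> t))) \<in> E\<^sup>*"
      if ih: "i \<in> index \<alpha> - J" "h \<in> parabolic \<alpha> J" for i h
    proof -
      have "(el i h, el i (h \<otimes>\<^bsub>grp \<alpha>\<^esub> s)) \<in> E\<^sup>*"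
        "(el i (h \<otimes>\<^bsub>grp \<alpha>\<^esub> s), el i (h \<otimes>\<^bsub>grp \<alpha>\<^esub> s \<otimes>\<^bsub>grp \<alpha>\<^esub> t)) \<in> E\<^sup>*"
        using st ih by (simp_all add: S_def)
      then show ?thesis
        using st ih by (auto simp: S_def m_assoc intro: rtrancl_trans)
    qed
    then show "s \<otimes>\<^bsub>grp \<alpha>\<^esub> t \<in> S"
      using st by (simp add: S_def)
  qed
  moreover have "parabolic \<alpha> (index \<alpha> - {x}) \<subseteq> S" if x: "x \<in> index \<alpha> - J" for x
  proof
    fix s assume s: "s \<in> parabolic \<alpha> (index \<alpha> - {x})"
    have sJ: "s \<in> parabolic \<alpha> J"
      using s x J(1) parabolic_antimono[of J "index \<alpha> - {x}" \<alpha>] by blast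
    \<comment> \<open>Rank at least two provides a type \<open>k\<close> other than
      \<open>x\<close>. The generator \<open>s\<close> lies in \<open>G_k\<close>, so
      \<open>el k h\<close> and \<open>el k (h s)\<close> are the same element, a bridge between
      \<open>el i h\<close> and \<open>el i (h s)\<close>.\<close>
    have "index \<alpha> - J \<noteq> {x}"
      using J(2) by auto
    then obtain k where k: "k \<in> index \<alpha> - J" "k \<noteq> x"
      using x by blast
    have "(el i h, el i (h \<otimes>\<^bsub>grp \<alpha>\<^esub> s)) \<in> E\<^sup>*" if ih: "i \<in> index \<alpha> - J" "h \<in> parabolic \<alpha> J" for i h
    proof -
      have "s \<in> par \<alpha> k"
        using s k by (simp add: parabolic_def)
      then have "g \<otimes>\<^bsub>grp \<alpha>\<^esub> h \<otimes>\<^bsub>grp \<alpha>\<^esub> s \<in> g \<otimes>\<^bsub>grp \<alpha>\<^esub> h <#\<^bsub>grp \<alpha>\<^esub> par \<alpha> k"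
        by (auto simp: l_coset_def)
      then have "el k h = el k (h \<otimes>\<^bsub>grp \<alpha>\<^esub> s)"
        using coset_repr(2)[of k "g \<otimes>\<^bsub>grp \<alpha>\<^esub> h"] k ih g(1) sJ by (simp add: el_def m_assoc)
      moreover have "(el i h, el k h) \<in> E" "(el k (h \<otimes>\<^bsub>grp \<alpha>\<^esub> s), el i (h \<otimes>\<^bsub>grp \<alpha>\<^esub> s)) \<in> E"
        using inc k ih sJ by auto
      ultimately show ?thesis
        by (simp add: rtrancl.rtrancl_into_rtrancl[OF r_into_rtrancl])
    qed
    then show "s \<in> S"
      using sJ by (simp add: S_def)
  qed
  ultimately have "parabolic \<alpha> J \<subseteq> S"
    using gen J(1) unfolding corank_one_generated_def by blast
  then have same: "(el i \<one>\<^bsub>grp \<alpha>\<^esub>, el i h) \<in> E\<^sup>*" if "i \<in> index \<alpha> - J" "h \<in> parabolic \<alpha> J" for i h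
    using that P.one_closed P.mem_carrier unfolding S_def by fastforce
  have "(el i h, el k h') \<in> E\<^sup>*"
    if "i \<in> index \<alpha> - J" "h \<in> parabolic \<alpha> J" "k \<in> index \<alpha> - J" "h' \<in> parabolic \<alpha> J" for i h k h'
    using sym[OF same[OF that(1,2)]] inc[OF that(1,3) P.one_closed] same[OF that(3,4)]
    by (meson rtrancl.rtrancl_into_rtrancl rtrancl_trans)
  then have "(x, y) \<in> E\<^sup>*" if "x \<in> elements ?R" "y \<in> elements ?R" for x y
    using that unfolding elts by blast
  then show "connected_incidence_graph ?R"
    by (simp add: connected_incidence_graph_def E_def)
qed

end

text \<open>Everything about the twisting is checked through this criterion. The descriptions of
  thinness and residual connectedness become available once \<open>flags_meet\<close> is
  known.\<close>

theorem regular_hypertope_iff: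
  "regular_hypertope \<alpha> \<longleftrightarrow>
     coset_incidence \<alpha> \<and> flags_meet \<alpha> \<and> borel \<alpha> = {\<one>\<^bsub>grp \<alpha>\<^esub>} \<and>
     (\<forall>i\<in>index \<alpha>. card (parabolic \<alpha> (index \<alpha> - {i})) = 2) \<and> corank_one_generated \<alpha>"
proof (cases "coset_incidence \<alpha>")
  case True
  then interpret coset_incidence \<alpha> .
  show ?thesis
    unfolding regular_hypertope_def coset_incidence_system_iff
    using True flags_meet_iff thin_iff corank_one_generatedI residually_connectedI by blast
qed (simp add: regular_hypertope_def coset_incidence_system_iff)

section \<open>Twistings\<close>

text \<open>Injectivity of \<open>par\<close> lets \<open>index_action\<close> recover an index from
  its subgroup; for a regular hypertope it follows from thinness and the trivial Borel subgroup. The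
  last two assumptions are admissibility with the representatives \<open>F\<close> fixed.\<close>

locale twisting_system = A: coset_incidence \<alpha> + B: coset_incidence \<beta>
  for \<alpha> :: "('a, 'i) coset_system" and \<beta> :: "('b, 'j) coset_system" +
  fixes \<phi> :: "'b \<Rightarrow> 'a \<Rightarrow> 'a" and F :: "'i set \<Rightarrow> 'i"
  assumes hom: "\<phi> \<in> hom (grp \<beta>) (AutoGroup (grp \<alpha>))"
    and par_inj: "inj_on (par \<alpha>) (index \<alpha>)"
    and permutes: "b \<in> carrier (grp \<beta>) \<Longrightarrow> bij_betw ((`) (\<phi> b)) (par \<alpha> ` index \<alpha>) (par \<alpha> ` index \<alpha>)"
    and repr: "L \<in> index_orbits \<alpha> \<beta> \<phi> \<Longrightarrow> admissible_representative \<alpha> \<beta> \<phi> L (F L)"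
begin

abbreviation act :: "'b \<Rightarrow> 'i \<Rightarrow> 'i" where "act \<equiv> index_action \<alpha> \<phi>"
abbreviation \<K> :: "'i set set" where "\<K> \<equiv> index_orbits \<alpha> \<beta> \<phi>"
abbreviation \<T> :: "('a \<times> 'b, 'j + 'i set) coset_system" where "\<T> \<equiv> twisting \<alpha> \<beta> \<phi> F"

section \<open>The action of \<open>B\<close> on \<open>A\<close> by automorphisms\<close>

lemma phi_auto: "b \<in> carrier (grp \<beta>) \<Longrightarrow> \<phi> b \<in> auto (grp \<alpha>)"
  using hom by (auto simp: hom_def AutoGroup_def)

lemma phi_bij: "b \<in> carrier (grp \<beta>) \<Longrightarrow> bij_betw (\<phi> b) (carrier (grp \<alpha>)) (carrier (grp \<alpha>))"
  using phi_auto by (auto simp: auto_def Bij_def)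

lemma phi_closed [simp]:
  "b \<in> carrier (grp \<beta>) \<Longrightarrow> a \<in> carrier (grp \<alpha>) \<Longrightarrow> \<phi> b a \<in> carrier (grp \<alpha>)"
  using phi_bij bij_betwE by blast

lemma phi_inj: "b \<in> carrier (grp \<beta>) \<Longrightarrow> inj_on (\<phi> b) (carrier (grp \<alpha>))"
  using phi_bij bij_betw_imp_inj_on by blast

lemma phi_hom: "b \<in> carrier (grp \<beta>) \<Longrightarrow> \<phi> b \<in> hom (grp \<alpha>) (grp \<alpha>)"
  using phi_auto by (auto simp: auto_def)

lemma phi_mult [simp]:
  "b \<in> carrier (grp \<beta>) \<Longrightarrow> a \<in> carrier (grp \<alpha>) \<Longrightarrow> a' \<in> carrier (grp \<alpha>) \<Longrightarrow>
    \<phi> b (a \<otimes>\<^bsub>grp \<alpha>\<^esub> a') = \<phi> b a \<otimes>\<^bsub>grp \<alpha>\<^esub> \<phi> b a'"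
  using phi_hom by (simp add: hom_mult)

lemma phi_group_hom: "b \<in> carrier (grp \<beta>) \<Longrightarrow> group_hom (grp \<alpha>) (grp \<alpha>) (\<phi> b)"
  by (simp add: group_hom_def group_hom_axioms_def A.is_group phi_hom)

lemma phi_one_right [simp]: "b \<in> carrier (grp \<beta>) \<Longrightarrow> \<phi> b \<one>\<^bsub>grp \<alpha>\<^esub> = \<one>\<^bsub>grp \<alpha>\<^esub>"
  using group_hom.hom_one[OF phi_group_hom] by simp

lemma phi_inv [simp]:
  "b \<in> carrier (grp \<beta>) \<Longrightarrow> a \<in> carrier (grp \<alpha>) \<Longrightarrow> \<phi> b (inv\<^bsub>grp \<alpha>\<^esub> a) = inv\<^bsub>grp \<alpha>\<^esub> \<phi> b a"
  using group_hom.hom_inv[OF phi_group_hom] by simp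

lemma phi_phi:
  assumes "b \<in> carrier (grp \<beta>)" "b' \<in> carrier (grp \<beta>)" "a \<in> carrier (grp \<alpha>)"
  shows "\<phi> (b \<otimes>\<^bsub>grp \<beta>\<^esub> b') a = \<phi> b (\<phi> b' a)"
proof -
  \<comment> \<open>Multiplication in \<open>AutoGroup\<close> is \<open>compose\<close>, which
    agrees with composition only on the carrier.\<close>
  have "\<phi> (b \<otimes>\<^bsub>grp \<beta>\<^esub> b') = compose (carrier (grp \<alpha>)) (\<phi> b) (\<phi> b')"
    using hom assms phi_auto[of b] phi_auto[of b']
    by (simp add: hom_mult[OF hom] AutoGroup_def BijGroup_def auto_def)
  then show ?thesis
    using assms(3) by (simp add: compose_def)
qed

text \<open>The map at the identity is idempotent and injective, hence fixes every element of the
  carrier.\<close>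

lemma phi_one_left [simp]: "a \<in> carrier (grp \<alpha>) \<Longrightarrow> \<phi> \<one>\<^bsub>grp \<beta>\<^esub> a = a"
  using phi_phi[of "\<one>\<^bsub>grp \<beta>\<^esub>" "\<one>\<^bsub>grp \<beta>\<^esub>" a] inj_onD[OF phi_inj[OF B.one_closed]] by simp

section \<open>The induced action of \<open>B\<close> on the types of \<alpha>\<close>

lemma act:
  assumes "b \<in> carrier (grp \<beta>)" "i \<in> index \<alpha>"
  shows act_mem: "act b i \<in> index \<alpha>" and par_act: "par \<alpha> (act b i) = \<phi> b ` par \<alpha> i"
proof -
  have "\<phi> b ` par \<alpha> i \<in> par \<alpha> ` index \<alpha>"
    using bij_betwE[OF permutes[OF assms(1)]] assms(2) by blast
  then show "act b i \<in> index \<alpha>" "par \<alpha> (act b i) = \<phi> b ` par \<alpha> i"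
    unfolding index_action_def
    using the_inv_into_into[OF par_inj _ order_refl] f_the_inv_into_f[OF par_inj] by simp_all
qed

lemma act_mult:
  assumes "b \<in> carrier (grp \<beta>)" "b' \<in> carrier (grp \<beta>)" "i \<in> index \<alpha>"
  shows "act (b \<otimes>\<^bsub>grp \<beta>\<^esub> b') i = act b (act b' i)"
proof -
  have "par \<alpha> i \<subseteq> carrier (grp \<alpha>)"
    using A.par_subgroup assms(3) subgroup.subset by blast
  then have "par \<alpha> (act (b \<otimes>\<^bsub>grp \<beta>\<^esub> b') i) = par \<alpha> (act b (act b' i))"
    using assms by (auto simp: par_act act_mem image_image phi_phi subset_iff intro!: image_cong)
  then show ?thesis
    using assms act_mem par_inj by (simp add: inj_on_eq_iff)
qed

lemma act_one [simp]:
  assumes "i \<in> index \<alpha>"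
  shows "act \<one>\<^bsub>grp \<beta>\<^esub> i = i"
proof -
  have "par \<alpha> i \<subseteq> carrier (grp \<alpha>)"
    using A.par_subgroup assms subgroup.subset by blast
  then have "par \<alpha> (act \<one>\<^bsub>grp \<beta>\<^esub> i) = par \<alpha> i"
    using assms by (auto simp: par_act subset_iff image_iff)
  then show ?thesis
    using assms act_mem par_inj by (simp add: inj_on_eq_iff)
qed

lemma act_inv [simp]:
  assumes "b \<in> carrier (grp \<beta>)" "i \<in> index \<alpha>"
  shows "act (inv\<^bsub>grp \<beta>\<^esub> b) (act b i) = i" "act b (act (inv\<^bsub>grp \<beta>\<^esub> b) i) = i"
  using assms by (simp_all flip: act_mult)

text \<open>Each \<open>\<phi> b\<close> carries \<open>A_i\<close> onto \<open>A_{b i}\<close>; as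
  it is injective on the carrier, membership is also reflected.\<close>

lemma phi_mem_parabolic_iff:
  assumes "b \<in> carrier (grp \<beta>)" "a \<in> carrier (grp \<alpha>)" "X \<subseteq> index \<alpha>"
  shows "\<phi> b a \<in> parabolic \<alpha> (act b ` X) \<longleftrightarrow> a \<in> parabolic \<alpha> X"
proof -
  have "\<phi> b a \<in> par \<alpha> (act b i) \<longleftrightarrow> a \<in> par \<alpha> i" if "i \<in> X" for i
  proof -
    have "i \<in> index \<alpha>" using that assms(3) by blast
    then show ?thesis
      using inj_on_image_mem_iff[OF phi_inj[OF assms(1)] assms(2) subgroup.subset[OF A.par_subgroup]]
      by (simp add: par_act assms(1))
  qed
  then show ?thesis
    using assms by (simp add: parabolic_def)
qed

section \<open>Orbits on the types of \<alpha> and the admissibility condition\<close>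

lemma sub_orbit_iff: "x \<in> sub_orbit \<alpha> \<beta> \<phi> H f \<longleftrightarrow> (\<exists>h\<in>H. x = act h f)"
  by (auto simp: sub_orbit_def orbit_def)

lemma index_orbits_eq: "\<K> = (\<lambda>x. sub_orbit \<alpha> \<beta> \<phi> (carrier (grp \<beta>)) x) ` index \<alpha>"
  by (auto simp: index_orbits_def orbits_def sub_orbit_def orbit_def)

lemma finite_index_orbits: "finite \<K>"
  by (simp add: index_orbits_eq A.finite_index)

lemma Union_index_orbits: "\<Union>\<K> = index \<alpha>"
proof
  show "\<Union>\<K> \<subseteq> index \<alpha>"
    by (auto simp: index_orbits_eq sub_orbit_iff act_mem)
  show "index \<alpha> \<subseteq> \<Union>\<K>"
  proof
    fix i assume i: "i \<in> index \<alpha>"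
    then have "i \<in> sub_orbit \<alpha> \<beta> \<phi> (carrier (grp \<beta>)) i"
      unfolding sub_orbit_iff by (intro bexI[of _ "\<one>\<^bsub>grp \<beta>\<^esub>"]) simp_all
    then show "i \<in> \<Union>\<K>"
      using i by (auto simp: index_orbits_eq)
  qed
qed

lemma index_orbit_eq:
  assumes "L \<in> \<K>" "x \<in> L"
  shows "L = sub_orbit \<alpha> \<beta> \<phi> (carrier (grp \<beta>)) x"
proof -
  obtain y b where y: "y \<in> index \<alpha>" "L = sub_orbit \<alpha> \<beta> \<phi> (carrier (grp \<beta>)) y"
    and b: "b \<in> carrier (grp \<beta>)" "x = act b y"
    using assms by (auto simp: index_orbits_eq sub_orbit_iff)
  have "act c y = act (c \<otimes>\<^bsub>grp \<beta>\<^esub> inv\<^bsub>grp \<beta>\<^esub> b) x" if "c \<in> carrier (grp \<beta>)" for c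
    using that b y(1) by (simp add: act_mult act_mem)
  moreover have "act c x = act (c \<otimes>\<^bsub>grp \<beta>\<^esub> b) y" if "c \<in> carrier (grp \<beta>)" for c
    using that b y(1) by (simp add: act_mult)
  ultimately show ?thesis
    unfolding y(2) set_eq_iff sub_orbit_iff
    using b(1) B.m_closed B.inv_closed by metis
qed

lemma index_orbit_unique: "L \<in> \<K> \<Longrightarrow> L' \<in> \<K> \<Longrightarrow> x \<in> L \<Longrightarrow> x \<in> L' \<Longrightarrow> L = L'"
  using index_orbit_eq by metis

lemma act_mem_orbit: "L \<in> \<K> \<Longrightarrow> x \<in> L \<Longrightarrow> b \<in> carrier (grp \<beta>) \<Longrightarrow> act b x \<in> L"
  using index_orbit_eq[of L x] sub_orbit_iff by blast

lemma repr_mem: "L \<in> \<K> \<Longrightarrow> F L \<in> L"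
  using repr by (simp add: admissible_representative_def)

text \<open>Admissibility read through complements in \<open>index \<beta>\<close>, which turn the
  intersection of index sets into a union.\<close>

lemma sub_orbit_parabolic_Int:
  assumes "L \<in> \<K>" "N \<subseteq> index \<beta>" "N' \<subseteq> index \<beta>"
  shows "sub_orbit \<alpha> \<beta> \<phi> (parabolic \<beta> (N \<union> N')) (F L) =
    sub_orbit \<alpha> \<beta> \<phi> (parabolic \<beta> N) (F L) \<inter> sub_orbit \<alpha> \<beta> \<phi> (parabolic \<beta> N') (F L)"
proof -
  have "index \<beta> - (index \<beta> - N) = N" "index \<beta> - (index \<beta> - N') = N'"
    "index \<beta> - ((index \<beta> - N) \<inter> (index \<beta> - N')) = N \<union> N'"
    using assms by blast+
  then show ?thesis
    using repr[OF assms(1)] unfolding admissible_representative_def by (metis Diff_subset)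
qed

text \<open>Iterating admissibility shows that \<open>B_N F_L\<close> is cut out of \<open>L\<close>
  by the orbits under the single \<open>B_i\<close>. For empty \<open>N\<close> the parabolic is all
  of \<open>B\<close>, whose orbit is \<open>L\<close> itself.\<close>

lemma mem_sub_orbit_parabolic_iff:
  assumes L: "L \<in> \<K>" "x \<in> L" and N: "N \<subseteq> index \<beta>"
  shows "x \<in> sub_orbit \<alpha> \<beta> \<phi> (parabolic \<beta> N) (F L) \<longleftrightarrow>
    (\<forall>i\<in>N. x \<in> sub_orbit \<alpha> \<beta> \<phi> (par \<beta> i) (F L))"
proof -
  have "finite N" using N B.finite_index finite_subset by blast
  then show ?thesis
    using N
  proof (induction N)
    case empty
    show ?case
      using L index_orbit_eq[OF L(1) repr_mem[OF L(1)]] by (simp add: parabolic_def)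
  next
    case (insert i N)
    then show ?case
      using sub_orbit_parabolic_Int[OF L(1), of "{i}" N] by (simp add: B.parabolic_singleton)
  qed
qed

section \<open>The semidirect product as a group\<close>

lemma carrier_twisting: "carrier (grp \<T>) = carrier (grp \<alpha>) \<times> carrier (grp \<beta>)"
  by (simp add: twisting_def semidirect_product_def)

lemma mult_twisting: "(a, b) \<otimes>\<^bsub>grp \<T>\<^esub> (a', b') = (a \<otimes>\<^bsub>grp \<alpha>\<^esub> \<phi> b a', b \<otimes>\<^bsub>grp \<beta>\<^esub> b')"
  by (simp add: twisting_def semidirect_product_def)

lemma one_twisting: "\<one>\<^bsub>grp \<T>\<^esub> = (\<one>\<^bsub>grp \<alpha>\<^esub>, \<one>\<^bsub>grp \<beta>\<^esub>)"
  by (simp add: twisting_def semidirect_product_def)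

lemma left_inverse_twisting:
  assumes "a \<in> carrier (grp \<alpha>)" "b \<in> carrier (grp \<beta>)"
  shows "(\<phi> (inv\<^bsub>grp \<beta>\<^esub> b) (inv\<^bsub>grp \<alpha>\<^esub> a), inv\<^bsub>grp \<beta>\<^esub> b) \<otimes>\<^bsub>grp \<T>\<^esub> (a, b) = \<one>\<^bsub>grp \<T>\<^esub>"
  using assms by (simp add: mult_twisting one_twisting)

lemma group_twisting: "group (grp \<T>)"
proof (rule groupI)
  show "\<one>\<^bsub>grp \<T>\<^esub> \<in> carrier (grp \<T>)"
    by (simp add: carrier_twisting one_twisting)
  fix x assume "x \<in> carrier (grp \<T>)"
  then obtain a b where x: "x = (a, b)" "a \<in> carrier (grp \<alpha>)" "b \<in> carrier (grp \<beta>)"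
    by (auto simp: carrier_twisting)
  show "\<one>\<^bsub>grp \<T>\<^esub> \<otimes>\<^bsub>grp \<T>\<^esub> x = x"
    using x by (simp add: mult_twisting one_twisting)
  have "(\<phi> (inv\<^bsub>grp \<beta>\<^esub> b) (inv\<^bsub>grp \<alpha>\<^esub> a), inv\<^bsub>grp \<beta>\<^esub> b) \<in> carrier (grp \<T>)"
    using x by (simp add: carrier_twisting)
  then show "\<exists>y\<in>carrier (grp \<T>). y \<otimes>\<^bsub>grp \<T>\<^esub> x = \<one>\<^bsub>grp \<T>\<^esub>"
    using left_inverse_twisting x by blast
  fix y assume "y \<in> carrier (grp \<T>)"
  then obtain a' b' where y: "y = (a', b')" "a' \<in> carrier (grp \<alpha>)" "b' \<in> carrier (grp \<beta>)"
    by (auto simp: carrier_twisting)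
  show "x \<otimes>\<^bsub>grp \<T>\<^esub> y \<in> carrier (grp \<T>)"
    using x y by (simp add: carrier_twisting mult_twisting)
  fix z assume "z \<in> carrier (grp \<T>)"
  then obtain a'' b'' where z: "z = (a'', b'')" "a'' \<in> carrier (grp \<alpha>)" "b'' \<in> carrier (grp \<beta>)"
    by (auto simp: carrier_twisting)
  show "x \<otimes>\<^bsub>grp \<T>\<^esub> y \<otimes>\<^bsub>grp \<T>\<^esub> z = x \<otimes>\<^bsub>grp \<T>\<^esub> (y \<otimes>\<^bsub>grp \<T>\<^esub> z)"
    using x y z by (simp add: mult_twisting A.m_assoc B.m_assoc phi_phi)
qed

sublocale T: group "grp \<T>" by (rule group_twisting)

lemma inv_twisting:
  assumes "a \<in> carrier (grp \<alpha>)" "b \<in> carrier (grp \<beta>)"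
  shows "inv\<^bsub>grp \<T>\<^esub> (a, b) = (\<phi> (inv\<^bsub>grp \<beta>\<^esub> b) (inv\<^bsub>grp \<alpha>\<^esub> a), inv\<^bsub>grp \<beta>\<^esub> b)"
  using assms left_inverse_twisting by (intro T.inv_equality) (simp_all add: carrier_twisting)

section \<open>Parabolic subgroups of the twisting and their cosets\<close>

definition support :: "'j + 'i set \<Rightarrow> 'i set" where
  "support = case_sum (\<lambda>i. \<Union>L\<in>\<K>. L - sub_orbit \<alpha> \<beta> \<phi> (par \<beta> i) (F L)) (\<lambda>L. L)"

definition right_factor :: "'j + 'i set \<Rightarrow> 'b set" where
  "right_factor = case_sum (par \<beta>) (\<lambda>_. carrier (grp \<beta>))"

text \<open>A common shape for both kinds of maximal parabolic, which spares later arguments a case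
  split. For \<open>Inl i\<close> the support is what the orbits \<open>B_i F_L\<close> leave over
  in \<alpha>'s types.\<close>

lemma par_twisting: "par \<T> t = parabolic \<alpha> (support t) \<times> right_factor t"
  by (simp add: twisting_def support_def right_factor_def split: sum.split)

lemma index_twisting: "index \<T> = index \<beta> <+> \<K>"
  by (simp add: twisting_def)

lemma support_subset: "t \<in> index \<T> \<Longrightarrow> support t \<subseteq> index \<alpha>"
  using Union_index_orbits by (auto simp: support_def index_twisting)

lemma right_factor_subgroup: "t \<in> index \<T> \<Longrightarrow> subgroup (right_factor t) (grp \<beta>)"
  using B.par_subgroup B.subgroup_self by (auto simp: right_factor_def index_twisting)

text \<open>An orbit \<open>L\<close> is stable under \<open>B\<close>, and the complement in
  \<open>L\<close> of an orbit of \<open>B_i\<close> is stable under \<open>B_i\<close>. Hence the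
  right factor normalizes the left one, which makes their product a subgroup.\<close>

lemma act_support:
  assumes t: "t \<in> index \<T>" and b: "b \<in> right_factor t"
  shows "act b ` support t = support t"
proof -
  have sub: "act c x \<in> support t" if c: "c \<in> right_factor t" and x: "x \<in> support t" for c x
  proof (cases t)
    case (Inr L)
    then show ?thesis
      using x c t act_mem_orbit by (auto simp: support_def right_factor_def index_twisting)
  next
    case (Inl i)
    then have i: "i \<in> index \<beta>" and ci: "c \<in> par \<beta> i"
      using t c by (auto simp: index_twisting right_factor_def)
    interpret P: subgroup "par \<beta> i" "grp \<beta>" by (rule B.par_subgroup[OF i])
    obtain L where L: "L \<in> \<K>" "x \<in> L" "x \<notin> sub_orbit \<alpha> \<beta> \<phi> (par \<beta> i) (F L)"
      using x Inl by (auto simp: support_def)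
    have xI: "x \<in> index \<alpha>" "F L \<in> index \<alpha>"
      using L(1,2) repr_mem Union_index_orbits by blast+
    have "act c x \<notin> sub_orbit \<alpha> \<beta> \<phi> (par \<beta> i) (F L)"
    proof
      assume "act c x \<in> sub_orbit \<alpha> \<beta> \<phi> (par \<beta> i) (F L)"
      then obtain h where h: "h \<in> par \<beta> i" "act c x = act h (F L)"
        by (auto simp: sub_orbit_iff)
      then have "x = act (inv\<^bsub>grp \<beta>\<^esub> c) (act h (F L))"
        using act_inv(1)[of c x] ci xI by simp
      also have "\<dots> = act (inv\<^bsub>grp \<beta>\<^esub> c \<otimes>\<^bsub>grp \<beta>\<^esub> h) (F L)"
        using ci h(1) xI by (simp add: act_mult)
      finally have "x \<in> sub_orbit \<alpha> \<beta> \<phi> (par \<beta> i) (F L)"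
        unfolding sub_orbit_iff by (rule bexI) (simp add: ci h(1))
      then show False
        using L(3) by contradiction
    qed
    moreover have "act c x \<in> L"
      using act_mem_orbit L(1,2) ci by simp
    ultimately show ?thesis
      using Inl L(1) by (auto simp: support_def)
  qed
  interpret Q: subgroup "right_factor t" "grp \<beta>" by (rule right_factor_subgroup[OF t])
  \<comment> \<open>Stability under the inverse of \<open>b\<close> upgrades inclusion to
    equality.\<close>
  have "x \<in> act b ` support t" if "x \<in> support t" for x
  proof
    show "x = act b (act (inv\<^bsub>grp \<beta>\<^esub> b) x)"
      using b that support_subset[OF t] by (simp add: subset_iff)
    show "act (inv\<^bsub>grp \<beta>\<^esub> b) x \<in> support t"
      using sub that b by simp
  qed
  then show ?thesis
    using sub[OF b] by (intro subset_antisym image_subsetI subsetI)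
qed

lemma subgroup_par_twisting:
  assumes t: "t \<in> index \<T>"
  shows "subgroup (par \<T> t) (grp \<T>)"
proof -
  interpret Q: subgroup "right_factor t" "grp \<beta>" by (rule right_factor_subgroup[OF t])
  interpret P: subgroup "parabolic \<alpha> (support t)" "grp \<alpha>"
    by (rule A.parabolic_subgroup[OF support_subset[OF t]])
  have phi: "\<phi> b a \<in> parabolic \<alpha> (support t)"
    if "b \<in> right_factor t" "a \<in> parabolic \<alpha> (support t)" for a b
    using phi_mem_parabolic_iff[of b a "support t"] that act_support[OF t] support_subset[OF t] by simp
  show ?thesis
  proof (rule T.subgroupI)
    show "par \<T> t \<subseteq> carrier (grp \<T>)"
      by (auto simp: par_twisting carrier_twisting)
    show "par \<T> t \<noteq> {}"
      using P.one_closed Q.one_closed unfolding par_twisting by blast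
    show "inv\<^bsub>grp \<T>\<^esub> x \<in> par \<T> t" if "x \<in> par \<T> t" for x
      using that phi by (auto simp: par_twisting inv_twisting)
    show "x \<otimes>\<^bsub>grp \<T>\<^esub> y \<in> par \<T> t" if "x \<in> par \<T> t" "y \<in> par \<T> t" for x y
      using that phi by (auto simp: par_twisting mult_twisting)
  qed
qed

sublocale T: coset_incidence \<T>
proof (intro coset_incidence.intro coset_incidence_axioms.intro group_twisting)
  show "finite (index \<T>)"
    by (simp add: index_twisting B.finite_index finite_index_orbits)
qed (rule subgroup_par_twisting)

text \<open>Intersecting parabolics of \<alpha> unites their supports. A type \<open>x\<close> in
  the orbit \<open>L\<close> escapes this union iff \<open>L\<close> is not in \<open>M\<close> and
  \<open>x\<close> lies in \<open>B_i F_L\<close> for all \<open>i\<close> in \<open>N\<close>; by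
  admissibility the latter means \<open>x\<close> lies in \<open>B_N F_L\<close>.\<close>

lemma parabolic_twisting:
  assumes N: "N \<subseteq> index \<beta>" and M: "M \<subseteq> \<K>"
  shows "parabolic \<T> (N <+> M) =
    parabolic \<alpha> (index \<alpha> - (\<Union>L\<in>\<K> - M. sub_orbit \<alpha> \<beta> \<phi> (parabolic \<beta> N) (F L))) \<times> parabolic \<beta> N"
proof -
  have "x \<in> (\<Union>t\<in>N <+> M. support t) \<longleftrightarrow>
      x \<in> index \<alpha> - (\<Union>L\<in>\<K> - M. sub_orbit \<alpha> \<beta> \<phi> (parabolic \<beta> N) (F L))" for x
  proof (cases "x \<in> index \<alpha>")
    case False
    have "N <+> M \<subseteq> index \<T>"
      using N M by (auto simp: index_twisting)
    then show ?thesis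
      using False support_subset by blast
  next
    case True
    then obtain L where L: "L \<in> \<K>" "x \<in> L"
      using Union_index_orbits by blast
    \<comment> \<open>Orbits are disjoint, so quantifiers over orbits containing \<open>x\<close>
      collapse to the single orbit \<open>L\<close>.\<close>
    have uniq: "L' \<in> \<K> \<and> x \<in> L' \<longleftrightarrow> L' = L" for L'
      using index_orbit_unique[OF L(1) _ L(2)] L by metis
    have "x \<in> (\<Union>t\<in>N <+> M. support t) \<longleftrightarrow>
        (\<exists>i\<in>N. x \<notin> sub_orbit \<alpha> \<beta> \<phi> (par \<beta> i) (F L)) \<or> L \<in> M"
    proof -
      have "x \<in> support (Inl i) \<longleftrightarrow> x \<notin> sub_orbit \<alpha> \<beta> \<phi> (par \<beta> i) (F L)" for i
      proof -
        have "x \<in> support (Inl i) \<longleftrightarrow>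
            (\<exists>L'. (L' \<in> \<K> \<and> x \<in> L') \<and> x \<notin> sub_orbit \<alpha> \<beta> \<phi> (par \<beta> i) (F L'))"
          by (auto simp: support_def)
        then show ?thesis
          by (simp add: uniq)
      qed
      moreover have "(\<exists>L'\<in>M. x \<in> support (Inr L')) \<longleftrightarrow> L \<in> M"
      proof -
        have "(\<exists>L'\<in>M. x \<in> support (Inr L')) \<longleftrightarrow> (\<exists>L'. (L' \<in> \<K> \<and> x \<in> L') \<and> L' \<in> M)"
          using M by (auto simp: support_def)
        then show ?thesis
          by (simp add: uniq)
      qed
      ultimately show ?thesis by (simp add: Plus_def bex_Un)
    qed
    also have "\<dots> \<longleftrightarrow> x \<notin> sub_orbit \<alpha> \<beta> \<phi> (parabolic \<beta> N) (F L) \<or> L \<in> M"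
      using mem_sub_orbit_parabolic_iff[OF L N] by blast
    also have "\<dots> \<longleftrightarrow> (\<forall>L'\<in>\<K> - M. x \<notin> sub_orbit \<alpha> \<beta> \<phi> (parabolic \<beta> N) (F L'))"
    proof -
      have "sub_orbit \<alpha> \<beta> \<phi> (parabolic \<beta> N) (F L') \<subseteq> L'" if "L' \<in> \<K>" for L'
        using act_mem_orbit[OF that repr_mem[OF that]] subsetD[OF parabolic_subset[of \<beta> N]]
        by (auto simp: sub_orbit_iff)
      then have "(\<forall>L'\<in>\<K> - M. x \<notin> sub_orbit \<alpha> \<beta> \<phi> (parabolic \<beta> N) (F L')) \<longleftrightarrow>
          (\<forall>L'. (L' \<in> \<K> \<and> x \<in> L') \<longrightarrow> L' \<in> M \<or> x \<notin> sub_orbit \<alpha> \<beta> \<phi> (parabolic \<beta> N) (F L'))"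
        by blast
      then show ?thesis
        by (auto simp: uniq)
    qed
    finally show ?thesis
      using True by blast
  qed
  then have "(\<Union>t\<in>N <+> M. support t) =
      index \<alpha> - (\<Union>L\<in>\<K> - M. sub_orbit \<alpha> \<beta> \<phi> (parabolic \<beta> N) (F L))"
    by blast
  moreover have "parabolic \<T> (N <+> M) = parabolic \<alpha> (\<Union>t\<in>N <+> M. support t) \<times> parabolic \<beta> N"
  proof -
    have "(a, b) \<in> parabolic \<T> (N <+> M) \<longleftrightarrow>
        a \<in> parabolic \<alpha> (\<Union>t\<in>N <+> M. support t) \<and> b \<in> parabolic \<beta> N" for a b
    proof -
      have "(a, b) \<in> parabolic \<T> (N <+> M) \<longleftrightarrow>
          (a \<in> carrier (grp \<alpha>) \<and> (\<forall>t\<in>N <+> M. a \<in> parabolic \<alpha> (support t))) \<and>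
          (b \<in> carrier (grp \<beta>) \<and> (\<forall>t\<in>N <+> M. b \<in> right_factor t))"
        unfolding parabolic_def[of \<T>] by (auto simp: par_twisting carrier_twisting)
      moreover have "b \<in> carrier (grp \<beta>) \<and> (\<forall>t\<in>N <+> M. b \<in> right_factor t) \<longleftrightarrow> b \<in> parabolic \<beta> N"
        by (auto simp: parabolic_def right_factor_def Plus_def ball_Un)
      moreover have "a \<in> carrier (grp \<alpha>) \<and> (\<forall>t\<in>N <+> M. a \<in> parabolic \<alpha> (support t)) \<longleftrightarrow>
          a \<in> parabolic \<alpha> (\<Union>t\<in>N <+> M. support t)"
        by (auto simp: parabolic_def)
      ultimately show ?thesis by simp
    qed
    then show ?thesis by auto
  qed
  ultimately show ?thesis by simp
qed

text \<open>Since \<open>(a, b)^-1 (c, d)\<close> is \<open>(\<phi>(b^-1)(a^-1 c), b^-1 d)\<close>,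
  the first condition transports along \<open>\<phi> b\<close> to \<open>a^-1 c\<close> lying in the
  parabolic of the translated support. That coset is split into cosets of maximal parabolics because
  these are elements of \<alpha>'s geometry.\<close>

lemma coset_twisting:
  assumes t: "t \<in> index \<T>" and g: "g \<in> carrier (grp \<T>)"
  shows "x \<in> g <#\<^bsub>grp \<T>\<^esub> par \<T> t \<longleftrightarrow>
    fst x \<in> carrier (grp \<alpha>) \<and> (\<forall>y\<in>act (snd g) ` support t. fst x \<in> fst g <#\<^bsub>grp \<alpha>\<^esub> par \<alpha> y) \<and>
    snd x \<in> snd g <#\<^bsub>grp \<beta>\<^esub> right_factor t"
proof -
  obtain a b where ab: "g = (a, b)" "a \<in> carrier (grp \<alpha>)" "b \<in> carrier (grp \<beta>)"
    using g by (auto simp: carrier_twisting)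
  have sup: "support t \<subseteq> index \<alpha>"
    by (rule support_subset[OF t])
  show ?thesis
  proof (cases "x \<in> carrier (grp \<T>)")
    case True
    then obtain c d where cd: "x = (c, d)" "c \<in> carrier (grp \<alpha>)" "d \<in> carrier (grp \<beta>)"
      by (auto simp: carrier_twisting)
    let ?a = "\<phi> (inv\<^bsub>grp \<beta>\<^esub> b) (inv\<^bsub>grp \<alpha>\<^esub> a \<otimes>\<^bsub>grp \<alpha>\<^esub> c)"
    have "inv\<^bsub>grp \<T>\<^esub> g \<otimes>\<^bsub>grp \<T>\<^esub> x = (?a, inv\<^bsub>grp \<beta>\<^esub> b \<otimes>\<^bsub>grp \<beta>\<^esub> d)"
      using ab cd by (simp add: inv_twisting mult_twisting)
    moreover have "?a \<in> parabolic \<alpha> (support t) \<longleftrightarrow>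
        (\<forall>y\<in>act b ` support t. c \<in> a <#\<^bsub>grp \<alpha>\<^esub> par \<alpha> y)"
    proof -
      have "\<phi> b ?a = inv\<^bsub>grp \<alpha>\<^esub> a \<otimes>\<^bsub>grp \<alpha>\<^esub> c"
        using ab cd by (simp flip: phi_phi del: phi_mult)
      then have "?a \<in> parabolic \<alpha> (support t) \<longleftrightarrow>
          inv\<^bsub>grp \<alpha>\<^esub> a \<otimes>\<^bsub>grp \<alpha>\<^esub> c \<in> parabolic \<alpha> (act b ` support t)"
        using phi_mem_parabolic_iff[of b ?a "support t"] ab cd sup by simp
      also have "\<dots> \<longleftrightarrow> (\<forall>y\<in>act b ` support t. c \<in> a <#\<^bsub>grp \<alpha>\<^esub> par \<alpha> y)"
      proof -
        have "c \<in> a <#\<^bsub>grp \<alpha>\<^esub> par \<alpha> y \<longleftrightarrow> inv\<^bsub>grp \<alpha>\<^esub> a \<otimes>\<^bsub>grp \<alpha>\<^esub> c \<in> par \<alpha> y"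
          if "y \<in> act b ` support t" for y
          using that sup ab cd A.mem_l_coset_iff[OF A.par_subgroup] act_mem by auto
        then show ?thesis
          using ab cd by (simp add: parabolic_def)
      qed
      finally show ?thesis .
    qed
    moreover have "d \<in> b <#\<^bsub>grp \<beta>\<^esub> right_factor t \<longleftrightarrow> inv\<^bsub>grp \<beta>\<^esub> b \<otimes>\<^bsub>grp \<beta>\<^esub> d \<in> right_factor t"
      using B.mem_l_coset_iff[OF right_factor_subgroup[OF t] ab(3)] cd(3) by simp
    moreover have "x \<in> g <#\<^bsub>grp \<T>\<^esub> par \<T> t \<longleftrightarrow> inv\<^bsub>grp \<T>\<^esub> g \<otimes>\<^bsub>grp \<T>\<^esub> x \<in> par \<T> t"
      using T.mem_l_coset_iff[OF subgroup_par_twisting[OF t] g] True by simp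
    ultimately show ?thesis
      using ab cd by (simp add: par_twisting)
  next
    case False
    then show ?thesis
      using T.mem_l_coset_iff[OF subgroup_par_twisting[OF t] g]
        B.mem_l_coset_iff[OF right_factor_subgroup[OF t] ab(3)] ab(1)
      by (cases x) (auto simp: carrier_twisting)
  qed
qed

section \<open>Common group elements for flags of the twisting\<close>

lemma flags_meet_twisting:
  assumes "flags_meet \<alpha>" "flags_meet \<beta>"
  shows "flags_meet \<T>"
  unfolding flags_meet_def
proof (intro allI impI)
  fix \<Phi> assume flag: "flag (coset_geometry \<T>) \<Phi>"
  then have "\<forall>x\<in>\<Phi>. \<exists>g. fst x \<in> index \<T> \<and> g \<in> carrier (grp \<T>) \<and> snd x = g <#\<^bsub>grp \<T>\<^esub> par \<T> (fst x)"
    unfolding T.flag_iff T.elements_iff subset_iff by (metis fst_conv snd_conv)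
  then obtain r where r: "\<And>x. x \<in> \<Phi> \<Longrightarrow> fst x \<in> index \<T>" "\<And>x. x \<in> \<Phi> \<Longrightarrow> r x \<in> carrier (grp \<T>)"
      "\<And>x. x \<in> \<Phi> \<Longrightarrow> snd x = r x <#\<^bsub>grp \<T>\<^esub> par \<T> (fst x)"
    by metis
  have fst_r: "fst (r x) \<in> carrier (grp \<alpha>)" and snd_r: "snd (r x) \<in> carrier (grp \<beta>)" if "x \<in> \<Phi>" for x
    using r(2)[OF that] by (auto simp: carrier_twisting)
  have coset: "g \<in> snd x \<longleftrightarrow> fst g \<in> carrier (grp \<alpha>) \<and>
      (\<forall>y\<in>act (snd (r x)) ` support (fst x). fst g \<in> fst (r x) <#\<^bsub>grp \<alpha>\<^esub> par \<alpha> y) \<and>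
      snd g \<in> snd (r x) <#\<^bsub>grp \<beta>\<^esub> right_factor (fst x)" if "x \<in> \<Phi>" for x g
    using coset_twisting[OF r(1,2)[OF that]] r(3)[OF that] by simp
  have meet: "\<exists>g. g \<in> snd x \<and> g \<in> snd x'" if "x \<in> \<Phi>" "x' \<in> \<Phi>" for x x'
    using flag that unfolding T.flag_iff by blast
  \<comment> \<open>Only types \<open>Inl i\<close> enter: for \<open>Inr L\<close> the right factor
    is the whole group \<open>B\<close>.\<close>
  let ?\<Phi>\<^sub>B = "{(i, snd (r x) <#\<^bsub>grp \<beta>\<^esub> par \<beta> i) |x i. x \<in> \<Phi> \<and> fst x = Inl i}"
  have "flag (coset_geometry \<beta>) ?\<Phi>\<^sub>B"
    unfolding B.flag_iff
  proof (intro conjI ballI)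
    show "?\<Phi>\<^sub>B \<subseteq> elements (coset_geometry \<beta>)"
      using r(1) snd_r by (fastforce simp: B.elements_iff index_twisting)
    fix u v assume "u \<in> ?\<Phi>\<^sub>B" "v \<in> ?\<Phi>\<^sub>B"
    then obtain x i x' i' where "x \<in> \<Phi>" "fst x = Inl i" "u = (i, snd (r x) <#\<^bsub>grp \<beta>\<^esub> par \<beta> i)"
      "x' \<in> \<Phi>" "fst x' = Inl i'" "v = (i', snd (r x') <#\<^bsub>grp \<beta>\<^esub> par \<beta> i')"
      by blast
    then show "snd u \<inter> snd v \<noteq> {}"
      using meet[of x x'] coset[of x] coset[of x'] by (auto simp: right_factor_def)
  qed
  then obtain b where b: "b \<in> carrier (grp \<beta>)" "\<forall>u\<in>?\<Phi>\<^sub>B. b \<in> snd u"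
    using assms(2) unfolding flags_meet_def by blast
  \<comment> \<open>Each element of the flag contributes the whole family of cosets over its
    translated support. Any two contributed cosets meet, even for one and the same \<open>x\<close>,
    because a common element of \<open>x\<close> and \<open>x'\<close> has its first component in
    both.\<close>
  let ?\<Phi>\<^sub>A = "{(y, fst (r x) <#\<^bsub>grp \<alpha>\<^esub> par \<alpha> y) |x y. x \<in> \<Phi> \<and> y \<in> act (snd (r x)) ` support (fst x)}"
  have "flag (coset_geometry \<alpha>) ?\<Phi>\<^sub>A"
    unfolding A.flag_iff
  proof (intro conjI ballI)
    show "?\<Phi>\<^sub>A \<subseteq> elements (coset_geometry \<alpha>)"
    proof clarify
      fix x i assume x: "x \<in> \<Phi>" and i: "i \<in> support (fst x)"
      have "act (snd (r x)) i \<in> index \<alpha>"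
        using act_mem snd_r[OF x] i support_subset[OF r(1)[OF x]] by blast
      then show "(act (snd (r x)) i, fst (r x) <#\<^bsub>grp \<alpha>\<^esub> par \<alpha> (act (snd (r x)) i)) \<in> elements (coset_geometry \<alpha>)"
        using A.element_mem fst_r[OF x] by blast
    qed
    fix u v assume "u \<in> ?\<Phi>\<^sub>A" "v \<in> ?\<Phi>\<^sub>A"
    then obtain x y x' y' where
      "x \<in> \<Phi>" "y \<in> act (snd (r x)) ` support (fst x)" "u = (y, fst (r x) <#\<^bsub>grp \<alpha>\<^esub> par \<alpha> y)"
      "x' \<in> \<Phi>" "y' \<in> act (snd (r x')) ` support (fst x')" "v = (y', fst (r x') <#\<^bsub>grp \<alpha>\<^esub> par \<alpha> y')"
      by blast
    then show "snd u \<inter> snd v \<noteq> {}"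
      using meet[of x x'] coset[of x] coset[of x'] by auto
  qed
  then obtain a where a: "a \<in> carrier (grp \<alpha>)" "\<forall>u\<in>?\<Phi>\<^sub>A. a \<in> snd u"
    using assms(1) unfolding flags_meet_def by blast
  have "(a, b) \<in> snd x" if x: "x \<in> \<Phi>" for x
  proof -
    have "b \<in> snd (r x) <#\<^bsub>grp \<beta>\<^esub> right_factor (fst x)"
    proof (cases "fst x")
      case (Inl i)
      then have "(i, snd (r x) <#\<^bsub>grp \<beta>\<^esub> par \<beta> i) \<in> ?\<Phi>\<^sub>B"
        using x by blast
      then have "b \<in> snd (i, snd (r x) <#\<^bsub>grp \<beta>\<^esub> par \<beta> i)"
        using b(2) by (rule bspec[rotated])
      then show ?thesis
        using Inl by (simp add: right_factor_def)
    next
      case (Inr L)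
      then show ?thesis
        using b(1) snd_r[OF x] B.mem_l_coset_iff[OF B.subgroup_self] by (simp add: right_factor_def)
    qed
    moreover have "a \<in> fst (r x) <#\<^bsub>grp \<alpha>\<^esub> par \<alpha> y" if "y \<in> act (snd (r x)) ` support (fst x)" for y
    proof -
      have "(y, fst (r x) <#\<^bsub>grp \<alpha>\<^esub> par \<alpha> y) \<in> ?\<Phi>\<^sub>A"
        using x that by blast
      then have "a \<in> snd (y, fst (r x) <#\<^bsub>grp \<alpha>\<^esub> par \<alpha> y)"
        using a(2) by (rule bspec[rotated])
      then show ?thesis by simp
    qed
    ultimately show ?thesis
      using coset[OF x] a(1) by simp
  qed
  then show "\<exists>g\<in>carrier (grp \<T>). \<forall>x\<in>\<Phi>. g \<in> snd x"
    using a(1) b(1) by (intro bexI[of _ "(a, b)"]) (auto simp: carrier_twisting)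
qed

section \<open>Corank one parabolics of the twisting and generation by them\<close>

lemma sub_orbit_one: "f \<in> index \<alpha> \<Longrightarrow> sub_orbit \<alpha> \<beta> \<phi> {\<one>\<^bsub>grp \<beta>\<^esub>} f = {f}"
  by (auto simp: sub_orbit_iff)

text \<open>With every orbit in \<open>M\<close>, nothing is removed from the types of \<alpha>, so
  the left factor is the Borel subgroup of \<alpha>.\<close>

lemma parabolic_corank_one_Inl:
  assumes "borel \<alpha> = {\<one>\<^bsub>grp \<alpha>\<^esub>}" "i \<in> index \<beta>"
  shows "parabolic \<T> (index \<T> - {Inl i}) = {\<one>\<^bsub>grp \<alpha>\<^esub>} \<times> parabolic \<beta> (index \<beta> - {i})"
proof -
  have "index \<T> - {Inl i} = (index \<beta> - {i}) <+> \<K>"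
    by (auto simp: index_twisting)
  then show ?thesis
    using parabolic_twisting[of "index \<beta> - {i}" \<K>] assms(1) by (simp add: borel_def)
qed

text \<open>Here \<open>B_N\<close> is the Borel subgroup of \<beta>, so the one remaining orbit
  \<open>B_N F_L\<close> shrinks to the representative.\<close>

lemma parabolic_corank_one_Inr:
  assumes "borel \<beta> = {\<one>\<^bsub>grp \<beta>\<^esub>}" "L \<in> \<K>"
  shows "parabolic \<T> (index \<T> - {Inr L}) = parabolic \<alpha> (index \<alpha> - {F L}) \<times> {\<one>\<^bsub>grp \<beta>\<^esub>}"
proof -
  have "index \<T> - {Inr L} = index \<beta> <+> (\<K> - {L})" "\<K> - (\<K> - {L}) = {L}" "F L \<in> index \<alpha>"
    using assms(2) repr_mem Union_index_orbits by (auto simp: index_twisting)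
  then show ?thesis
    using parabolic_twisting[of "index \<beta>" "\<K> - {L}"] assms(1) by (simp add: borel_def sub_orbit_one)
qed

lemma corank_one_generated_twisting:
  assumes gen: "corank_one_generated \<alpha>" "corank_one_generated \<beta>"
    and borel: "borel \<alpha> = {\<one>\<^bsub>grp \<alpha>\<^esub>}" "borel \<beta> = {\<one>\<^bsub>grp \<beta>\<^esub>}"
  shows "corank_one_generated \<T>"
  unfolding corank_one_generated_def
proof (intro allI impI, elim conjE)
  fix J S assume J: "J \<subseteq> index \<T>" and S: "subgroup S (grp \<T>)"
    and sub: "\<forall>t\<in>index \<T> - J. parabolic \<T> (index \<T> - {t}) \<subseteq> S"
  interpret S: subgroup S "grp \<T>" by (rule S)
  have S_mult: "(a \<otimes>\<^bsub>grp \<alpha>\<^esub> \<phi> b a', b \<otimes>\<^bsub>grp \<beta>\<^esub> b') \<in> S" if "(a, b) \<in> S" "(a', b') \<in> S" for a b a' b'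
    using S.m_closed[OF that] by (simp add: mult_twisting)
  have S_inv: "(\<phi> (inv\<^bsub>grp \<beta>\<^esub> b) (inv\<^bsub>grp \<alpha>\<^esub> a), inv\<^bsub>grp \<beta>\<^esub> b) \<in> S" if "(a, b) \<in> S" for a b
    using S.m_inv_closed[OF that] S.mem_carrier[OF that] by (simp add: inv_twisting carrier_twisting)
  have S_one: "(\<one>\<^bsub>grp \<alpha>\<^esub>, \<one>\<^bsub>grp \<beta>\<^esub>) \<in> S"
    using S.one_closed by (simp add: one_twisting)
  define N where "N = Inl -` J"
  define M where "M = Inr -` J"
  have J_eq: "J = N <+> M"
  proof (rule Set.set_eqI)
    show "t \<in> J \<longleftrightarrow> t \<in> N <+> M" for t
      by (cases t) (auto simp: N_def M_def)
  qed
  have NM: "N \<subseteq> index \<beta>" "M \<subseteq> \<K>"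
    using J by (auto simp: N_def M_def index_twisting)
  \<comment> \<open>The slice of \<open>S\<close> over the identity of \<open>A\<close>. It contains
    the generators of \<open>B_N\<close>, coming from the types \<open>Inl i\<close> outside
    \<open>J\<close>.\<close>
  let ?SB = "{b \<in> carrier (grp \<beta>). (\<one>\<^bsub>grp \<alpha>\<^esub>, b) \<in> S}"
  have "subgroup ?SB (grp \<beta>)"
  proof (rule B.subgroupI)
    show "?SB \<noteq> {}" using S_one by auto
    show "inv\<^bsub>grp \<beta>\<^esub> b \<in> ?SB" if "b \<in> ?SB" for b
      using that S_inv[of "\<one>\<^bsub>grp \<alpha>\<^esub>" b] by simp
    show "b \<otimes>\<^bsub>grp \<beta>\<^esub> c \<in> ?SB" if "b \<in> ?SB" "c \<in> ?SB" for b c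
      using that S_mult[of "\<one>\<^bsub>grp \<alpha>\<^esub>" b "\<one>\<^bsub>grp \<alpha>\<^esub>" c] by simp
  qed auto
  moreover have "parabolic \<beta> (index \<beta> - {i}) \<subseteq> ?SB" if i: "i \<in> index \<beta> - N" for i
  proof -
    have "Inl i \<in> index \<T> - J"
      using i by (auto simp: N_def index_twisting)
    then have "{\<one>\<^bsub>grp \<alpha>\<^esub>} \<times> parabolic \<beta> (index \<beta> - {i}) \<subseteq> S"
      using sub i parabolic_corank_one_Inl[OF borel(1), of i] by force
    then show ?thesis
      using parabolic_subset[of \<beta>] by auto
  qed
  ultimately have PB: "parabolic \<beta> N \<subseteq> ?SB"
    using gen(2) NM(1) unfolding corank_one_generated_def by blast
  \<comment> \<open>The slice over the identity of \<open>B\<close>. Types \<open>Inr L\<close>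
    outside \<open>J\<close> give it only the generators of type \<open>F L\<close>; conjugation by
    \<open>B_N\<close> supplies the rest of each orbit.\<close>
  let ?SA = "{a \<in> carrier (grp \<alpha>). (a, \<one>\<^bsub>grp \<beta>\<^esub>) \<in> S}"
  let ?U = "\<Union>L\<in>\<K> - M. sub_orbit \<alpha> \<beta> \<phi> (parabolic \<beta> N) (F L)"
  have "subgroup ?SA (grp \<alpha>)"
  proof (rule A.subgroupI)
    show "?SA \<noteq> {}" using S_one by auto
    show "inv\<^bsub>grp \<alpha>\<^esub> a \<in> ?SA" if "a \<in> ?SA" for a
      using that S_inv[of a "\<one>\<^bsub>grp \<beta>\<^esub>"] by simp
    show "a \<otimes>\<^bsub>grp \<alpha>\<^esub> c \<in> ?SA" if "a \<in> ?SA" "c \<in> ?SA" for a c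
      using that S_mult[of a "\<one>\<^bsub>grp \<beta>\<^esub>" c "\<one>\<^bsub>grp \<beta>\<^esub>"] by simp
  qed auto
  moreover have "parabolic \<alpha> (index \<alpha> - {x}) \<subseteq> ?SA" if x: "x \<in> index \<alpha> - (index \<alpha> - ?U)" for x
  proof
    obtain L b where L: "L \<in> \<K>" "L \<notin> M" and bN: "b \<in> parabolic \<beta> N" and x_eq: "x = act b (F L)"
      using x by (auto simp: sub_orbit_iff)
    have b: "b \<in> carrier (grp \<beta>)" "(\<one>\<^bsub>grp \<alpha>\<^esub>, b) \<in> S"
      using bN PB by auto
    have FL: "F L \<in> index \<alpha>"
      using L repr_mem Union_index_orbits by blast
    \<comment> \<open>As \<open>b\<close> permutes the types and sends \<open>F L\<close> to
      \<open>x\<close>, the map \<open>\<phi> b\<close> carries the generator group of type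
      \<open>F L\<close> onto that of type \<open>x\<close>.\<close>
    have act_image: "act b ` (index \<alpha> - {F L}) = index \<alpha> - {x}"
    proof
      show "act b ` (index \<alpha> - {F L}) \<subseteq> index \<alpha> - {x}"
      proof
        fix y assume "y \<in> act b ` (index \<alpha> - {F L})"
        then obtain z where z: "z \<in> index \<alpha>" "z \<noteq> F L" "y = act b z"
          by blast
        then have "y \<noteq> x"
          using x_eq act_inv(1)[OF b(1) z(1)] act_inv(1)[OF b(1) FL] by auto
        then show "y \<in> index \<alpha> - {x}"
          using z b(1) act_mem by simp
      qed
      show "index \<alpha> - {x} \<subseteq> act b ` (index \<alpha> - {F L})"
      proof
        fix y assume y: "y \<in> index \<alpha> - {x}"
        then have *: "y = act b (act (inv\<^bsub>grp \<beta>\<^esub> b) y)" "act (inv\<^bsub>grp \<beta>\<^esub> b) y \<in> index \<alpha>"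
          using b(1) act_mem by simp_all
        then have "act (inv\<^bsub>grp \<beta>\<^esub> b) y \<noteq> F L"
          using y x_eq by auto
        then show "y \<in> act b ` (index \<alpha> - {F L})"
          using * by (intro image_eqI[of _ _ "act (inv\<^bsub>grp \<beta>\<^esub> b) y"]) simp_all
      qed
    qed
    fix a assume a: "a \<in> parabolic \<alpha> (index \<alpha> - {x})"
    then have "a \<in> carrier (grp \<alpha>)"
      by (simp add: parabolic_def)
    then obtain c where c: "c \<in> carrier (grp \<alpha>)" "a = \<phi> b c"
      using phi_bij[OF b(1)] by (auto simp: bij_betw_def)
    have "c \<in> parabolic \<alpha> (index \<alpha> - {F L})"
      using phi_mem_parabolic_iff[OF b(1) c(1), of "index \<alpha> - {F L}"] a c(2) act_image by simp
    moreover have "Inr L \<in> index \<T> - J"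
      using L by (auto simp: M_def index_twisting)
    then have "parabolic \<alpha> (index \<alpha> - {F L}) \<times> {\<one>\<^bsub>grp \<beta>\<^esub>} \<subseteq> S"
      using sub parabolic_corank_one_Inr[OF borel(2) L(1)] by force
    ultimately have "(c, \<one>\<^bsub>grp \<beta>\<^esub>) \<in> S"
      by blast
    \<comment> \<open>Conjugation in two products: \<open>(1, b)(c, 1)\<close> is
      \<open>(\<phi> b c, b)\<close>, and the inverse of \<open>(1, b)\<close> then clears the
      second component.\<close>
    then have "(\<phi> b c, b) \<in> S"
      using S_mult[OF b(2)] b(1) c(1) by fastforce
    from S_mult[OF this S_inv[OF b(2)]] have "(a, \<one>\<^bsub>grp \<beta>\<^esub>) \<in> S"
      using b(1) c by simp
    then show "a \<in> ?SA"
      using b(1) c by simp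
  qed
  ultimately have PA: "parabolic \<alpha> (index \<alpha> - ?U) \<subseteq> ?SA"
    using gen(1) unfolding corank_one_generated_def by (metis (no_types, lifting) Diff_subset)
  have "(a, b) \<in> S" if "a \<in> parabolic \<alpha> (index \<alpha> - ?U)" "b \<in> parabolic \<beta> N" for a b
  proof -
    have "a \<in> ?SA" "b \<in> ?SB"
      using that PA PB by blast+
    then show ?thesis
      \<comment> \<open>The factorization \<open>(a, b) = (a, 1)(1, b)\<close> joins the two
        slices.\<close>
      using S_mult[of a "\<one>\<^bsub>grp \<beta>\<^esub>" "\<one>\<^bsub>grp \<alpha>\<^esub>" b] by simp
  qed
  then show "parabolic \<T> J \<subseteq> S"
    unfolding J_eq parabolic_twisting[OF NM] by blast
qed

end

theorem corollary3p17:
  fixes \<alpha> :: "('a, 'i) coset_system"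
    and \<beta> :: "('b, 'j) coset_system"
    and \<phi> :: "'b \<Rightarrow> 'a \<Rightarrow> 'a"
    and F :: "'i set \<Rightarrow> 'i"
  assumes "regular_hypertope \<alpha>"
    and "regular_hypertope \<beta>"
    and "\<phi> \<in> hom (grp \<beta>) (AutoGroup (grp \<alpha>))"
    and "admissible \<alpha> \<beta> \<phi>"
    and "\<And>L. L \<in> index_orbits \<alpha> \<beta> \<phi> \<Longrightarrow> admissible_representative \<alpha> \<beta> \<phi> L (F L)"
  shows "regular_hypertope (twisting \<alpha> \<beta> \<phi> F)"
proof -
  note \<alpha> = assms(1)[unfolded regular_hypertope_iff] and \<beta> = assms(2)[unfolded regular_hypertope_iff]
  interpret A: coset_incidence \<alpha> using \<alpha> by blast
  interpret B: coset_incidence \<beta> using \<beta> by blast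
  have "inj_on (par \<alpha>) (index \<alpha>)"
  proof (rule inj_onI, rule ccontr)
    fix i j assume ij: "i \<in> index \<alpha>" "j \<in> index \<alpha>" "par \<alpha> i = par \<alpha> j" "i \<noteq> j"
    \<comment> \<open>Dropping \<open>i\<close> leaves the intersection unchanged because
      \<open>j\<close> still contributes the same subgroup. The parabolic would then have order one,
      against the order two given by thinness.\<close>
    then have "parabolic \<alpha> (index \<alpha> - {i}) = borel \<alpha>"
      by (auto simp: borel_def parabolic_def)
    then show False
      using \<alpha> ij(1) by (metis card_1_singleton_iff One_nat_def numeral_eq_one_iff semiring_norm(85))
  qed
  then interpret twisting_system \<alpha> \<beta> \<phi> F
    using assms by unfold_locales (auto simp: admissible_def)
  have borel: "borel \<alpha> = {\<one>\<^bsub>grp \<alpha>\<^esub>}" "borel \<beta> = {\<one>\<^bsub>grp \<beta>\<^esub>}"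
    using \<alpha> \<beta> by blast+
  have "flags_meet \<T>" "corank_one_generated \<T>"
    using flags_meet_twisting corank_one_generated_twisting \<alpha> \<beta> by blast+
  \<comment> \<open>Taking all types of \<beta> and all orbits gives the product of the two Borel
    subgroups.\<close>
  moreover have "borel \<T> = {\<one>\<^bsub>grp \<T>\<^esub>}"
    using parabolic_twisting[of "index \<beta>" \<K>] borel by (simp add: borel_def index_twisting one_twisting)
  moreover have "card (parabolic \<T> (index \<T> - {t})) = 2" if t: "t \<in> index \<T>" for t
  proof (cases t)
    case (Inl i)
    then have "i \<in> index \<beta>" using t by (auto simp: index_twisting)
    then show ?thesis
      using Inl \<beta> parabolic_corank_one_Inl[OF borel(1)] by (simp add: card_cartesian_product)
  next
    case (Inr L)
    then have L: "L \<in> \<K>" using t by (auto simp: index_twisting)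
    then have "F L \<in> index \<alpha>" using repr_mem Union_index_orbits by blast
    then show ?thesis
      using Inr L \<alpha> parabolic_corank_one_Inr[OF borel(2)] by (simp add: card_cartesian_product)
  qed
  ultimately show ?thesis
    unfolding regular_hypertope_iff using T.coset_incidence_axioms by blast
qed

end
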